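(* Let $n\in\mathbb{N}$, let $\Omega\subset\mathbb{R}^n$ be open, $p\in(1,+\infty)$, $s\in\left(0,\frac1p\right)$, and let $W\in C^1([-1,1],[0,+\infty))$ be such that, for some $\theta\in(-1,1)$, $\lambda\in(0,1]$, $\Lambda\in[1,+\infty)$ and $m\in[p,+\infty)$, $$\lambda\,\chi_{(-\infty,\theta]}(x)\,|1+x|^m\le W(x)\le\Lambda|1+x|^m\qquad\text{for every }x\in[-1,1],$$ and, for some $q\in(0,\theta+1]\cap(0,1)$ and $c_1\in(0,+\infty)$, $$c_1|1+x|^{m-1}\le W'(x)\qquad\text{for every }x\in(-1,-1+q).$$ Let $\theta_1,\theta_2\in(-1,\theta]$ and $$\theta_*:=\min\{\theta_1,\theta_2,-1+q\},\qquad \theta^*:=\max\{\theta_1,\theta_2,-1+q\}.$$ Assume that $u$ is a minimizer for $\mathcal{E}_s^p$ in $\Omega$ and that, for some $c_0,r_0\in(0,+\infty)$ such that $B_{r_0}\subset\Omega$, $$\mathcal{L}^n\big(B_{r_0}\cap\{u>\theta_1\}\big)>c_0.$$ Then there exist $R^*\in[r_0,+\infty)$, depending only on $s,n,p,m,\theta_*,r_0$, a constant $\tilde c\in(0,1)$, depending only on $s,n,p,m,\Lambda,c_1,\theta_*,r_0,c_0$, and a constant $c\in(0,+\infty)$, depending only on $m,\theta_*$, such that, for any $r\in[R^*,+\infty)$ with $B_{\frac{3r}{2}}\subset\Omega$, $$c\int_{B_r\cap\{\theta_*<u\le\theta^*\}}|1+u(x)|^m\,dx+\mathcal{L}^n\big(B_r\cap\{u>\theta_2\}\big)\ge\tilde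 c\,r^n.$$
   Context: $\chi_A$ is the characteristic function of $A$, $\mathcal{L}^n$ is the Lebesgue measure in $\mathbb{R}^n$, $B_r$ is the ball of radius $r$ centered at the origin. For measurable $u:\mathbb{R}^n\to\mathbb{R}$ and an open set $\Omega\subset\mathbb{R}^n$, $$\mathcal{K}_s^p(u,\Omega):=\frac12\int_\Omega\int_\Omega\frac{|u(x)-u(y)|^p}{|x-y|^{n+sp}}\,dx\,dy+\int_\Omega\int_{\mathbb{R}^n\setminus\Omega}\frac{|u(x)-u(y)|^p}{|x-y|^{n+sp}}\,dx\,dy,$$ $$\mathcal{E}_s^p(u,\Omega):=\mathcal{K}_s^p(u,\Omega)+\int_\Omega W(u(x))\,dx.$$ Set $X^{s,p}(\Omega):=\{u:\mathbb{R}^n\to\mathbb{R}\text{ measurable s.t. }\mathcal{K}_s^p(u,\Omega)<+\infty\text{ and }\|u\|_{L^\infty(\mathbb{R}^n)}\le1\}$. If $\Omega$ is bounded, $u\in X^{s,p}(\Omega)$ is a minimizer for $\mathcal{E}_s^p$ in $\Omega$ if $\mathcal{E}_s^p(u,\Omega)\le\mathcal{E}_s^p(v,\Omega)$ for any $v\in X^{s,p}(\Omega)$ with $v\equiv u$ in $\mathbb{R}^n\setminus\Omega$. If $\Omega$ is unbounded, $u\in X^{s,p}(\Omega)$ is a minimizer for $\mathcal{E}_s^p$ in $\Omega$ if it is a minimizer for $\mathcal{E}_s^p$ in every bounded open set $\Omega'\Subset\Omega$. *)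

theory Defs
  imports "HOL-Analysis.Analysis"
begin

text \<open>
  Some constants must not depend on the dimension, so the dimension is a natural number
  that is quantified inside formulas and not an index type. Points of \<open>n\<close>-space are the functions in
  \<^term>\<open>PiE {..<n} (\<lambda>_. UNIV :: real set)\<close>, which is both the space of the product measure and the
  topspace of \<^term>\<open>powertop_real {..<n}\<close>; the latter is the Euclidean topology, the index set being
  finite.
\<close>

definition Rn :: "nat \<Rightarrow> (nat \<Rightarrow> real) set" where
  "Rn n = PiE {..<n} (\<lambda>_. UNIV)"

definition Leb :: "nat \<Rightarrow> (nat \<Rightarrow> real) measure" where
  "Leb n = completion (PiM {..<n} (\<lambda>_. lborel))"

definition dist_Rn :: "nat \<Rightarrow> (nat \<Rightarrow> real) \<Rightarrow> (nat \<Rightarrow> real) \<Rightarrow> real" where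
  "dist_Rn n x y = L2_set (\<lambda>i. x i - y i) {..<n}"

definition ball_Rn :: "nat \<Rightarrow> real \<Rightarrow> (nat \<Rightarrow> real) set" where
  "ball_Rn n r = {x \<in> Rn n. L2_set x {..<n} < r}"

definition open_Rn :: "nat \<Rightarrow> (nat \<Rightarrow> real) set \<Rightarrow> bool" where
  "open_Rn n \<Omega> \<longleftrightarrow> openin (powertop_real {..<n}) \<Omega>"

definition bounded_Rn :: "nat \<Rightarrow> (nat \<Rightarrow> real) set \<Rightarrow> bool" where
  "bounded_Rn n \<Omega> \<longleftrightarrow> (\<exists>R. \<Omega> \<subseteq> ball_Rn n R)"

definition kernel_sp ::
  "nat \<Rightarrow> real \<Rightarrow> real \<Rightarrow> ((nat \<Rightarrow> real) \<Rightarrow> real) \<Rightarrow> (nat \<Rightarrow> real) \<Rightarrow> (nat \<Rightarrow> real) \<Rightarrow> ennreal" where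
  "kernel_sp n s p u x y =
     ennreal (\<bar>u x - u y\<bar> powr p / dist_Rn n x y powr (real n + s * p))"

definition K_energy ::
  "nat \<Rightarrow> real \<Rightarrow> real \<Rightarrow> ((nat \<Rightarrow> real) \<Rightarrow> real) \<Rightarrow> (nat \<Rightarrow> real) set \<Rightarrow> ennreal" where
  "K_energy n s p u \<Omega> =
     (1/2) * (\<integral>\<^sup>+y\<in>\<Omega>. (\<integral>\<^sup>+x\<in>\<Omega>. kernel_sp n s p u x y \<partial>Leb n) \<partial>Leb n)
     + (\<integral>\<^sup>+y\<in>\<Omega>. (\<integral>\<^sup>+x\<in>Rn n - \<Omega>. kernel_sp n s p u x y \<partial>Leb n) \<partial>Leb n)"

text \<open>
  The potential is a total function of which only the values on \<^term>\<open>{-1..1::real}\<close> matter: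
  the energy is only evaluated at functions with values in that interval almost everywhere.
\<close>

definition E_energy ::
  "nat \<Rightarrow> real \<Rightarrow> real \<Rightarrow> (real \<Rightarrow> real) \<Rightarrow> ((nat \<Rightarrow> real) \<Rightarrow> real) \<Rightarrow> (nat \<Rightarrow> real) set \<Rightarrow> ennreal" where
  "E_energy n s p W u \<Omega> =
     K_energy n s p u \<Omega> + (\<integral>\<^sup>+x\<in>\<Omega>. ennreal (W (u x)) \<partial>Leb n)"

definition X_space ::
  "nat \<Rightarrow> real \<Rightarrow> real \<Rightarrow> (nat \<Rightarrow> real) set \<Rightarrow> ((nat \<Rightarrow> real) \<Rightarrow> real) set" where
  "X_space n s p \<Omega> =
     {u \<in> borel_measurable (Leb n). K_energy n s p u \<Omega> < \<infinity> \<and> (AE x in Leb n. \<bar>u x\<bar> \<le> 1)}"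

definition minimizer_bdd ::
  "nat \<Rightarrow> real \<Rightarrow> real \<Rightarrow> (real \<Rightarrow> real) \<Rightarrow> (nat \<Rightarrow> real) set \<Rightarrow> ((nat \<Rightarrow> real) \<Rightarrow> real) \<Rightarrow> bool" where
  "minimizer_bdd n s p W \<Omega> u \<longleftrightarrow>
     u \<in> X_space n s p \<Omega> \<and>
     (\<forall>v \<in> X_space n s p \<Omega>. (\<forall>x \<in> Rn n - \<Omega>. v x = u x) \<longrightarrow>
        E_energy n s p W u \<Omega> \<le> E_energy n s p W v \<Omega>)"

text \<open>
  Compact containment of a bounded set in \<open>\<Omega>\<close> means that its closure lies in \<open>\<Omega>\<close>.
\<close>

definition minimizer ::
  "nat \<Rightarrow> real \<Rightarrow> real \<Rightarrow> (real \<Rightarrow> real) \<Rightarrow> (nat \<Rightarrow> real) set \<Rightarrow> ((nat \<Rightarrow> real) \<Rightarrow> real) \<Rightarrow> bool" where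
  "minimizer n s p W \<Omega> u \<longleftrightarrow>
     (if bounded_Rn n \<Omega> then minimizer_bdd n s p W \<Omega> u
      else u \<in> X_space n s p \<Omega> \<and>
        (\<forall>\<Omega>'. open_Rn n \<Omega>' \<and> bounded_Rn n \<Omega>' \<and> powertop_real {..<n} closure_of \<Omega>' \<subseteq> \<Omega>
            \<longrightarrow> minimizer_bdd n s p W \<Omega>' u))"

end

theory Submission
  imports Defs
begin

text \<open>
  Write \<open>U = 1 + u\<close>, \<open>\<Theta> = 1 + \<theta>\<^sub>*\<close> and \<open>V(r)\<close> for the volume of \<open>B\<^sub>r \<inter> {U > \<Theta>}\<close>; it suffices
  to bound \<open>V(r)\<close> from below by a multiple of \<open>r^n\<close>, since on \<open>{\<theta>\<^sub>* < u \<le> \<theta>^*}\<close> the integrand is at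
  least \<open>\<Theta>^m\<close>. As \<open>sp < 1\<close>, jumps have finite energy, so no regular barrier is needed: the competitor
  is \<open>u\<close> truncated at the level \<open>U = h\<close> inside \<open>B\<^sub>R\<close> and unchanged outside. Only pairs across the
  sphere of radius \<open>R\<close> lose energy, a point \<open>x\<close> at most a multiple of \<open>(R - |x|)^(-sp) (U(x) - h)\<close>;
  averaging over \<open>R \<in> [r, r + w]\<close> turns the weight into \<open>w^(-sp)\<close>. With \<open>h^(m-1)\<close> a large multiple
  of \<open>w^(-sp)\<close> the potential absorbs half of the excess \<open>\<Phi>(r)\<close> of \<open>U\<close> over \<open>h\<close> on
  \<open>B\<^sub>r \<inter> {U \<le> \<Theta>}\<close>, so \<open>\<Phi>(r) \<le> \<Phi>(r + w) / 2 + C V(r + w)\<close>. Iterating \<open>K\<close> times with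
  \<open>w = \<rho> / K\<close> makes \<open>\<Phi>(3\<rho>)\<close> at most \<open>2^(-K) (8\<rho>)^n + C V(4\<rho>)\<close>.
  If \<open>V(\<rho>) \<ge> \<delta> \<rho>^n\<close> but \<open>V(4\<rho>) < \<delta> (4\<rho>)^n\<close>, \<open>\<delta> = 2^(-K)\<close>, the interaction of
  \<open>{U > \<Theta>}\<close> with \<open>{U \<le> \<Theta>/2}\<close>, which the truncation removes, is at least of order
  \<open>\<delta>^(1 - sp/n) \<rho>^(n - sp)\<close> and at most of order \<open>K \<delta> \<rho>^(n - sp)\<close>. This is impossible for large
  \<open>K\<close>, so the density bound propagates from \<open>\<rho>\<close> to \<open>4\<rho>\<close>.
\<close>

subsection \<open>Lebesgue measure on functions\<close>

text \<open>Lebesgue measure before completion. Completing it changes no integral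
  (\<open>nn_integral_Leb\<close>), so the estimates are made here, with Borel integrands and
  Tonelli's theorem at hand.\<close>

abbreviation PiLeb :: "nat \<Rightarrow> (nat \<Rightarrow> real) measure" where
  "PiLeb n \<equiv> PiM {..<n} (\<lambda>_. lborel)"

lemma space_PiLeb: "space (PiLeb n) = Rn n"
  by (simp add: Rn_def space_PiM)

lemma nn_integral_Leb: "nn_integral (Leb n) f = nn_integral (PiLeb n) f"
  by (simp add: Leb_def nn_integral_completion)

lemma sigma_finite_PiLeb: "sigma_finite_measure (PiLeb n)"
proof -
  interpret product_sigma_finite "\<lambda>_::nat. lborel :: real measure" ..
  show ?thesis by (rule sigma_finite) simp
qed

lemma L2_set_measurable [measurable]:
  "(\<lambda>x. L2_set x {..<n}) \<in> borel_measurable (PiLeb n)"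
  unfolding L2_set_def by measurable

lemma dist_Rn_measurable [measurable]:
  assumes "f \<in> measurable N (PiLeb n)" "g \<in> measurable N (PiLeb n)"
  shows "(\<lambda>z. dist_Rn n (f z) (g z)) \<in> borel_measurable N"
proof -
  have [measurable]: "(\<lambda>z. f z i) \<in> borel_measurable N" "(\<lambda>z. g z i) \<in> borel_measurable N"
    if "i \<in> {..<n}" for i
    using measurable_compose[OF assms(1) measurable_component_singleton[OF that]]
      measurable_compose[OF assms(2) measurable_component_singleton[OF that]] by simp_all
  show ?thesis
    unfolding dist_Rn_def L2_set_def by measurable
qed

lemma ball_Rn_sets [measurable]: "ball_Rn n r \<in> sets (PiLeb n)"
  unfolding ball_Rn_def space_PiLeb[symmetric] by measurable

lemma Rn_sets [measurable]: "Rn n \<in> sets (PiLeb n)"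
  using sets.top[of "PiLeb n"] by (simp add: space_PiLeb)

lemma ball_Rn_mono: "r \<le> s \<Longrightarrow> ball_Rn n r \<subseteq> ball_Rn n s"
  by (auto simp: ball_Rn_def)

lemma dist_Rn_sym: "dist_Rn n x y = dist_Rn n y x"
  by (simp add: dist_Rn_def L2_set_def power2_commute)

lemma dist_Rn_nonneg [simp]: "0 \<le> dist_Rn n x y"
  by (simp add: dist_Rn_def)

lemma L2_set_le_dist_Rn: "L2_set y {..<n} \<le> L2_set x {..<n} + dist_Rn n x y"
proof -
  have "L2_set y {..<n} = L2_set (\<lambda>i. x i + (y i - x i)) {..<n}" by simp
  also have "\<dots> \<le> L2_set x {..<n} + dist_Rn n y x"
    unfolding dist_Rn_def by (rule L2_set_triangle_ineq)
  finally show ?thesis by (simp add: dist_Rn_sym)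
qed

section \<open>Volumes of cubes and balls\<close>

text \<open>Cubes have an explicit volume. They contain the balls of the same half-width, and around
  a given point they serve as test sets for lower bounds.\<close>

lemma emeasure_box:
  assumes "0 \<le> t"
  shows "emeasure (PiLeb n) (PiE {..<n} (\<lambda>i. {x i - t<..<x i + t})) = ennreal ((2 * t) ^ n)"
proof -
  interpret product_sigma_finite "\<lambda>_::nat. lborel :: real measure" ..
  have "emeasure (PiLeb n) (PiE {..<n} (\<lambda>i. {x i - t<..<x i + t}))
      = (\<Prod>i<n. emeasure lborel {x i - t<..<x i + t})"
    by (rule emeasure_PiM) auto
  also have "\<dots> = (\<Prod>i<n. ennreal (2 * t))"
    using assms by (intro prod.cong) auto
  finally show ?thesis
    using assms by (simp add: ennreal_power)
qed

lemma box_sets [measurable]: "PiE {..<n} (\<lambda>i. {x i - t<..<x i + t}) \<in> sets (PiLeb n)" for x :: "nat \<Rightarrow> real"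
  by (intro sets_PiM_I_finite) auto

lemma abs_le_dist_Rn:
  assumes "i < n"
  shows "\<bar>x i - y i\<bar> \<le> dist_Rn n x y"
proof -
  have "\<bar>x i - y i\<bar> \<le> L2_set (\<lambda>i. \<bar>x i - y i\<bar>) {..<n}"
    using assms by (intro member_le_L2_set) auto
  then show ?thesis by (simp add: dist_Rn_def L2_set_def)
qed

lemma emeasure_dist_less_le:
  assumes "0 \<le> t"
  shows "emeasure (PiLeb n) {y \<in> Rn n. dist_Rn n x y < t} \<le> ennreal ((2 * t) ^ n)"
proof -
  have "{y \<in> Rn n. dist_Rn n x y < t} \<subseteq> PiE {..<n} (\<lambda>i. {x i - t<..<x i + t})"
  proof
    fix y assume y: "y \<in> {y \<in> Rn n. dist_Rn n x y < t}"
    have "x i - t < y i \<and> y i < x i + t" if "i < n" for i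
      using abs_le_dist_Rn[OF that, of x y] y by auto
    with y show "y \<in> PiE {..<n} (\<lambda>i. {x i - t<..<x i + t})"
      by (auto simp: Rn_def PiE_iff)
  qed
  then show ?thesis
    unfolding emeasure_box[OF assms, where x=x and n=n, symmetric] by (intro emeasure_mono) auto
qed

lemma emeasure_ball_Rn_le:
  assumes "0 \<le> t"
  shows "emeasure (PiLeb n) (ball_Rn n t) \<le> ennreal ((2 * t) ^ n)"
  using emeasure_dist_less_le[OF assms, of n "\<lambda>_. 0"]
  by (simp add: ball_Rn_def dist_Rn_def L2_set_def)

text \<open>On the diagonal the kernel is \<open>1 / 0 = 0\<close>, so lower bounds for it can hold
  only almost everywhere. For \<open>n = 0\<close> the space would be a single point of mass
  one.\<close>

lemma AE_dist_Rn_pos: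
  assumes "1 \<le> n" and [simp]: "x \<in> Rn n"
  shows "AE y in PiLeb n. 0 < dist_Rn n x y"
proof -
  have [measurable]: "x \<in> space (PiLeb n)" by (simp add: space_PiLeb)
  define Z where "Z = {y \<in> space (PiLeb n). \<not> 0 < dist_Rn n x y}"
  have [measurable]: "Z \<in> sets (PiLeb n)"
    unfolding Z_def by measurable
  \<comment> \<open>Radius \<open>t / 2\<close> puts the ball into a cube of side \<open>t\<close>,
    whose volume \<open>t ^ n\<close> is at most \<open>t\<close>.\<close>
  have *: "emeasure (PiLeb n) Z \<le> ennreal t" if "0 < t" "t < 1" for t
  proof -
    have "emeasure (PiLeb n) Z \<le> emeasure (PiLeb n) {y \<in> Rn n. dist_Rn n x y < t / 2}"
      using that unfolding space_PiLeb[symmetric] by (intro emeasure_mono) (auto simp: Z_def)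
    also have "\<dots> \<le> ennreal ((2 * (t / 2)) ^ n)"
      using that by (intro emeasure_dist_less_le) auto
    also have "\<dots> \<le> ennreal t"
      using that assms power_decreasing[of 1 n t] by (intro ennreal_leI) auto
    finally show ?thesis .
  qed
  have "emeasure (PiLeb n) Z \<le> 0"
  proof (rule ennreal_le_epsilon)
    fix e :: real assume "0 < e"
    have "emeasure (PiLeb n) Z \<le> ennreal (min e (1/2))"
      using \<open>0 < e\<close> by (intro *) auto
    also have "\<dots> \<le> ennreal e" by (intro ennreal_leI) auto
    finally show "emeasure (PiLeb n) Z \<le> 0 + ennreal e" by simp
  qed
  then show ?thesis
    unfolding space_PiLeb[symmetric] by (intro AE_I[of _ _ Z]) (auto simp: Z_def)
qed

section \<open>Upper and lower bounds for integrals of the kernel\<close>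

text \<open>Dyadic decomposition: at distance between \<open>2 ^ k * r\<close> and
  \<open>2 ^ Suc k * r\<close> the kernel is at most \<open>(2 ^ k * r) powr -(n + a)\<close> and
  the volume at most \<open>(4 * (2 ^ k * r)) ^ n\<close>, so the shells contribute a geometric
  series of ratio \<open>2 powr -a\<close>.\<close>

lemma kernel_tail_le:
  assumes "0 < r" "0 < a" "x \<in> Rn n"
  shows "(\<integral>\<^sup>+y. indicator {y. r \<le> dist_Rn n x y} y * ennreal (1 / dist_Rn n x y powr (real n + a)) \<partial>PiLeb n)
    \<le> ennreal (4 ^ n / (1 - 2 powr -a) * r powr -a)"
proof -
  have [measurable]: "x \<in> space (PiLeb n)" using assms by (simp add: space_PiLeb)
  let ?D = "\<lambda>y. dist_Rn n x y"
  \<comment> \<open>\<open>f k\<close> bounds the kernel on the \<open>k\<close>-th shell; it lives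
    on the whole ball, to which the volume bound applies.\<close>
  define f :: "nat \<Rightarrow> (nat \<Rightarrow> real) \<Rightarrow> ennreal" where
    "f k y = ennreal (1 / (2 ^ k * r) powr (real n + a)) * indicator {y \<in> Rn n. ?D y < 2 ^ Suc k * r} y" for k y
  have [measurable]: "{y \<in> Rn n. ?D y < t} \<in> sets (PiLeb n)" for t
    unfolding space_PiLeb[symmetric] by measurable
  have [measurable]: "f k \<in> borel_measurable (PiLeb n)" for k
    unfolding f_def by measurable
  have pw: "indicator {y. r \<le> ?D y} y * ennreal (1 / ?D y powr (real n + a)) \<le> (\<Sum>k. f k y)"
    if y: "y \<in> space (PiLeb n)" for y
  proof (cases "r \<le> ?D y")
    case True
    define k where "k = nat \<lfloor>log 2 (?D y / r)\<rfloor>"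
    have pos: "1 \<le> ?D y / r" using True assms by simp
    then have l0: "0 \<le> log 2 (?D y / r)" by simp
    have "real k \<le> log 2 (?D y / r)" "log 2 (?D y / r) < real (Suc k)"
      unfolding k_def using l0 by (auto simp: of_nat_nat) linarith
    then have "2 powr real k \<le> ?D y / r" "?D y / r < 2 powr real (Suc k)"
      using pos by (auto simp: le_log_iff log_less_iff simp del: of_nat_Suc)
    then have "2 ^ k \<le> ?D y / r" "?D y / r < 2 ^ Suc k"
      by (simp_all only: powr_realpow zero_less_numeral)
    then have k: "2 ^ k * r \<le> ?D y" "?D y < 2 ^ Suc k * r"
      using assms by (auto simp: field_simps)
    have "ennreal (1 / ?D y powr (real n + a)) \<le> ennreal (1 / (2 ^ k * r) powr (real n + a))"
      using k assms by (intro ennreal_leI divide_left_mono powr_mono2 mult_pos_pos) auto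
    also have "\<dots> = f k y" using k y by (simp add: f_def space_PiLeb)
    also have "\<dots> \<le> (\<Sum>k. f k y)"
      using sum_le_suminf[of "\<lambda>k. f k y" "{k}"] by simp
    finally show ?thesis using True by simp
  qed simp
  have "(\<integral>\<^sup>+y. indicator {y. r \<le> ?D y} y * ennreal (1 / ?D y powr (real n + a)) \<partial>PiLeb n)
     \<le> (\<integral>\<^sup>+y. (\<Sum>k. f k y) \<partial>PiLeb n)"
    by (intro nn_integral_mono pw)
  also have "\<dots> = (\<Sum>k. \<integral>\<^sup>+y. f k y \<partial>PiLeb n)"
    by (intro nn_integral_suminf) measurable
  also have "\<dots> \<le> (\<Sum>k. ennreal (4 ^ n * r powr -a * (2 powr -a) ^ k))"
  proof (intro suminf_le summableI)
    fix k
    have "(\<integral>\<^sup>+y. f k y \<partial>PiLeb n) = ennreal (1 / (2 ^ k * r) powr (real n + a)) * emeasure (PiLeb n) {y \<in> Rn n. ?D y < 2 ^ Suc k * r}"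
      unfolding f_def by (subst nn_integral_cmult_indicator) auto
    also have "\<dots> \<le> ennreal (1 / (2 ^ k * r) powr (real n + a)) * ennreal ((2 * (2 ^ Suc k * r)) ^ n)"
      using assms by (intro mult_left_mono emeasure_dist_less_le) auto
    also have "\<dots> = ennreal (1 / (2 ^ k * r) powr (real n + a) * (2 * (2 ^ Suc k * r)) ^ n)"
      using assms by (intro ennreal_mult[symmetric]) auto
    also have "1 / (2 ^ k * r) powr (real n + a) * (2 * (2 ^ Suc k * r)) ^ n = 4 ^ n * (2 ^ k * r) powr -a"
    proof -
      have "(2 * (2 ^ Suc k * r)) ^ n = 4 ^ n * (2 ^ k * r) powr real n"
      proof -
        have "2 * (2 ^ Suc k * r) = 4 * (2 ^ k * r)" by simp
        then have "(2 * (2 ^ Suc k * r)) ^ n = 4 ^ n * (2 ^ k * r) ^ n"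
          by (simp only: power_mult_distrib)
        then show ?thesis
          using assms powr_realpow[of "2 ^ k * r" n] by simp
      qed
      moreover have "0 < (2 ^ k * r) powr real n" "0 < (2 ^ k * r) powr a"
        using assms by auto
      ultimately show ?thesis
        by (simp add: powr_add powr_minus_divide)
    qed
    also have "(2 ^ k * r) powr -a = r powr -a * (2 powr -a) ^ k"
    proof -
      have "(2 ^ k :: real) powr -a = (2 powr real k) powr -a"
        by (simp only: powr_realpow zero_less_numeral)
      also have "\<dots> = (2 powr -a) powr real k"
        by (simp add: powr_powr mult.commute)
      also have "\<dots> = (2 powr -a) ^ k"
        by (simp add: powr_realpow)
      finally show ?thesis
        using assms by (simp add: powr_mult)
    qed
    finally show "(\<integral>\<^sup>+y. f k y \<partial>PiLeb n) \<le> ennreal (4 ^ n * r powr -a * (2 powr -a) ^ k)"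
      by (simp add: mult.assoc)
  qed
  also have "\<dots> = ennreal (\<Sum>k. 4 ^ n * r powr -a * (2 powr -a) ^ k)"
    using assms by (intro suminf_ennreal2 summable_mult summable_geometric) (auto simp: powr_less_one)
  also have "(\<Sum>k. 4 ^ n * r powr -a * (2 powr -a) ^ k) = 4 ^ n * r powr -a * (1 / (1 - 2 powr -a))"
    using assms by (subst suminf_mult) (auto simp: suminf_geometric powr_less_one intro!: summable_geometric)
  finally show ?thesis by (simp add: field_simps)
qed

text \<open>The cube of half-side \<open>t\<close> around \<open>x\<close> lies in the larger ball,
  \<open>E\<close> takes at most half of it, and on the rest the kernel is at least its value at
  distance \<open>n * t\<close>. The smaller \<open>E\<close> is, the smaller \<open>t\<close> may
  be taken; this produces the exponent \<open>1 - sp/n\<close> of the density.\<close>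

lemma kernel_outside_ge:
  assumes n: "1 \<le> n" and a: "0 < a" and x: "x \<in> ball_Rn n \<rho>" and t: "0 < t" "real n * t \<le> \<rho>"
    and E [measurable]: "E \<in> sets (PiLeb n)"
    and mE: "emeasure (PiLeb n) (E \<inter> ball_Rn n (2 * \<rho>)) \<le> ennreal ((2 * t) ^ n / 2)"
  shows "ennreal ((2 * t) ^ n / 2 * (real n * t) powr -(real n + a))
    \<le> (\<integral>\<^sup>+y. indicator (ball_Rn n (2 * \<rho>) - E) y * ennreal (1 / dist_Rn n x y powr (real n + a)) \<partial>PiLeb n)"
proof -
  let ?Q = "PiE {..<n} (\<lambda>i. {x i - t<..<x i + t})"
  let ?B = "ball_Rn n (2 * \<rho>)"
  have d: "dist_Rn n x y \<le> real n * t" if "y \<in> ?Q" for y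
  proof -
    have "dist_Rn n x y \<le> (\<Sum>i<n. \<bar>x i - y i\<bar>)"
      unfolding dist_Rn_def by (rule L2_set_le_sum_abs)
    also have "\<dots> \<le> (\<Sum>i<n. t)"
    proof (rule sum_mono)
      fix i assume "i \<in> {..<n}"
      with that have "y i \<in> {x i - t<..<x i + t}" by (rule PiE_mem)
      then show "\<bar>x i - y i\<bar> \<le> t" by auto
    qed
    finally show ?thesis by simp
  qed
  have QB: "?Q \<subseteq> ?B"
  proof
    fix y assume y: "y \<in> ?Q"
    then have "L2_set y {..<n} < 2 * \<rho>"
      using L2_set_le_dist_Rn[where x=x and y=y and n=n] d[OF y] x t by (auto simp: ball_Rn_def)
    with y show "y \<in> ?B" by (auto simp: ball_Rn_def Rn_def PiE_iff)
  qed
  have "ennreal ((2 * t) ^ n) = emeasure (PiLeb n) ?Q"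
    using t by (simp add: emeasure_box)
  also have "\<dots> \<le> emeasure (PiLeb n) (?Q - E) + emeasure (PiLeb n) (E \<inter> ?B)"
    using QB by (intro order_trans[OF emeasure_mono emeasure_subadditive]) auto
  also have "\<dots> \<le> emeasure (PiLeb n) (?Q - E) + ennreal ((2 * t) ^ n / 2)"
    using mE by (intro add_left_mono)
  finally have "ennreal ((2 * t) ^ n) \<le> emeasure (PiLeb n) (?Q - E) + ennreal ((2 * t) ^ n / 2)" .
  moreover have "ennreal ((2 * t) ^ n) = ennreal ((2 * t) ^ n / 2) + ennreal ((2 * t) ^ n / 2)"
    by (subst ennreal_plus[symmetric]) (use t in auto)
  ultimately have "ennreal ((2 * t) ^ n / 2) + ennreal ((2 * t) ^ n / 2) \<le> emeasure (PiLeb n) (?Q - E) + ennreal ((2 * t) ^ n / 2)"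
    by simp
  then have m: "ennreal ((2 * t) ^ n / 2) \<le> emeasure (PiLeb n) (?Q - E)"
    by (simp add: ennreal_add_left_cancel_le add.commute)
  have "ennreal ((2 * t) ^ n / 2 * (real n * t) powr -(real n + a))
     = ennreal ((real n * t) powr -(real n + a)) * ennreal ((2 * t) ^ n / 2)"
    using t by (simp add: ennreal_mult'[symmetric] mult_ac)
  also have "\<dots> \<le> ennreal ((real n * t) powr -(real n + a)) * emeasure (PiLeb n) (?Q - E)"
    by (intro mult_left_mono m) auto
  also have "\<dots> = (\<integral>\<^sup>+y. ennreal ((real n * t) powr -(real n + a)) * indicator (?Q - E) y \<partial>PiLeb n)"
    by (subst nn_integral_cmult_indicator) auto
  also have "\<dots> \<le> (\<integral>\<^sup>+y. indicator (?B - E) y * ennreal (1 / dist_Rn n x y powr (real n + a)) \<partial>PiLeb n)"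
  proof (rule nn_integral_mono_AE)
    have "AE y in PiLeb n. 0 < dist_Rn n x y"
      using n x by (intro AE_dist_Rn_pos) (auto simp: ball_Rn_def)
    then show "AE y in PiLeb n. ennreal ((real n * t) powr -(real n + a)) * indicator (?Q - E) y
       \<le> indicator (?B - E) y * ennreal (1 / dist_Rn n x y powr (real n + a))"
    proof eventually_elim
      case (elim y)
      have "(real n * t) powr -(real n + a) \<le> 1 / dist_Rn n x y powr (real n + a)" if "y \<in> ?Q"
        unfolding powr_minus_divide using d[OF that] elim a n t
        by (intro divide_left_mono powr_mono2) auto
      then show ?case using QB by (auto simp: indicator_def ennreal_leI)
    qed
  qed
  finally show ?thesis .
qed

section \<open>Open sets and balls\<close>

text \<open>\<open>sets_PiM_equal_borel\<close> concerns functions on a whole index type. The set is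
  pulled back to such functions along the restriction \<open>?f\<close> and returned along the
  extension by zero \<open>?g\<close>; as \<open>?f (?g x) = x\<close> on \<open>Rn n\<close>, the
  result is \<Omega> again.\<close>

lemma open_Rn_sets:
  assumes "open_Rn n \<Omega>"
  shows "\<Omega> \<in> sets (PiLeb n)"
proof -
  let ?f = "\<lambda>x::nat \<Rightarrow> real. restrict x {..<n}"
  let ?g = "\<lambda>x::nat \<Rightarrow> real. \<lambda>i. if i < n then x i else 0"
  have sub: "\<Omega> \<subseteq> Rn n"
    using openin_subset[OF assms[unfolded open_Rn_def]] by (simp add: Rn_def)
  have "continuous_map (product_topology (\<lambda>_. euclidean) UNIV) (powertop_real {..<n}) ?f"
    by (auto simp: continuous_map_componentwise intro!: continuous_map_product_projection)
  from openin_continuous_map_preimage[OF this assms[unfolded open_Rn_def]]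
  have "open (?f -` \<Omega>)"
    by (simp add: open_fun_def vimage_def)
  then have A: "?f -` \<Omega> \<in> sets (Pi\<^sub>M UNIV (\<lambda>_::nat. borel :: real measure))"
    unfolding sets_PiM_equal_borel by simp
  have [measurable]: "?g \<in> measurable (PiLeb n) (Pi\<^sub>M UNIV (\<lambda>_. borel))"
  proof (rule measurable_PiM_single')
    fix i :: nat
    show "(\<lambda>x. if i < n then x i else 0) \<in> borel_measurable (PiLeb n)"
      using measurable_component_singleton[of i "{..<n}" "\<lambda>_. lborel"] by (cases "i < n") simp_all
  qed auto
  have "?g -` (?f -` \<Omega>) \<inter> space (PiLeb n) = \<Omega>"
  proof -
    have "?f (?g x) = x" if "x \<in> Rn n" for x
      using that by (auto simp: Rn_def PiE_iff extensional_def)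
    then show ?thesis using sub by (auto simp: space_PiLeb)
  qed
  then show ?thesis
    using measurable_sets[OF _ A, of ?g "PiLeb n"] by simp
qed

lemma topspace_powertop_Rn: "topspace (powertop_real {..<n}) = Rn n"
  by (simp add: Rn_def)

lemma continuous_map_L2_set:
  "continuous_map (powertop_real {..<n}) euclideanreal (\<lambda>x. L2_set x {..<n::nat})"
proof -
  have "continuous_map (powertop_real {..<n}) euclideanreal (\<lambda>x. \<Sum>i<n. (x i)\<^sup>2)"
    by (intro continuous_map_sum continuous_map_real_pow continuous_map_product_projection) auto
  moreover have "continuous_map euclideanreal euclideanreal sqrt"
    by (simp add: continuous_on_real_sqrt continuous_on_id)
  ultimately have "continuous_map (powertop_real {..<n}) euclideanreal (sqrt \<circ> (\<lambda>x. \<Sum>i<n. (x i)\<^sup>2))"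
    by (rule continuous_map_compose)
  then show ?thesis
    by (simp add: L2_set_def o_def)
qed

lemma open_Rn_ball_Rn: "open_Rn n (ball_Rn n r)"
proof -
  have "openin (powertop_real {..<n}) {x \<in> topspace (powertop_real {..<n}). L2_set x {..<n} \<in> {..<r}}"
    by (rule openin_continuous_map_preimage[OF continuous_map_L2_set]) simp
  then show ?thesis by (simp add: open_Rn_def ball_Rn_def Rn_def)
qed

lemma closure_of_ball_Rn_subset:
  assumes "r < s"
  shows "powertop_real {..<n} closure_of ball_Rn n r \<subseteq> ball_Rn n s"
proof -
  have "closedin (powertop_real {..<n}) {x \<in> topspace (powertop_real {..<n}). L2_set x {..<n} \<in> {..r}}"
    by (rule closedin_continuous_map_preimage[OF continuous_map_L2_set]) simp
  moreover have "ball_Rn n r \<subseteq> {x \<in> topspace (powertop_real {..<n}). L2_set x {..<n} \<in> {..r}}"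
    unfolding topspace_powertop_Rn by (auto simp: ball_Rn_def)
  ultimately have "powertop_real {..<n} closure_of ball_Rn n r
      \<subseteq> {x \<in> topspace (powertop_real {..<n}). L2_set x {..<n} \<in> {..r}}"
    by (rule closure_of_minimal[rotated])
  also have "\<dots> \<subseteq> ball_Rn n s"
    using assms unfolding topspace_powertop_Rn by (auto simp: ball_Rn_def)
  finally show ?thesis .
qed

section \<open>Changes on null sets\<close>

lemma AE_Leb_iff: "(AE x in Leb n. P x) \<longleftrightarrow> (AE x in PiLeb n. P x)"
  unfolding Leb_def by (rule AE_completion_iff)

lemma K_energy_cong_AE:
  assumes "AE x in PiLeb n. u x = v x"
  shows "K_energy n s p u \<Omega> = K_energy n s p v \<Omega>"
proof -
  have "(\<integral>\<^sup>+y\<in>\<Omega>. (\<integral>\<^sup>+x\<in>A. kernel_sp n s p u x y \<partial>PiLeb n) \<partial>PiLeb n)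
      = (\<integral>\<^sup>+y\<in>\<Omega>. (\<integral>\<^sup>+x\<in>A. kernel_sp n s p v x y \<partial>PiLeb n) \<partial>PiLeb n)" for A
    using assms
  proof (intro nn_integral_cong_AE, eventually_elim)
    case (elim y)
    have "(\<integral>\<^sup>+x\<in>A. kernel_sp n s p u x y \<partial>PiLeb n) = (\<integral>\<^sup>+x\<in>A. kernel_sp n s p v x y \<partial>PiLeb n)"
    proof (rule nn_integral_cong_AE)
      show "AE x in PiLeb n. kernel_sp n s p u x y * indicator A x = kernel_sp n s p v x y * indicator A x"
        using assms by eventually_elim (simp add: kernel_sp_def elim)
    qed
    then show ?case by simp
  qed
  then show ?thesis by (simp add: K_energy_def nn_integral_Leb)
qed

lemma E_energy_cong_AE:
  assumes "AE x in PiLeb n. u x = v x"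
  shows "E_energy n s p W u \<Omega> = E_energy n s p W v \<Omega>"
proof -
  have "(\<integral>\<^sup>+x\<in>\<Omega>. ennreal (W (u x)) \<partial>PiLeb n) = (\<integral>\<^sup>+x\<in>\<Omega>. ennreal (W (v x)) \<partial>PiLeb n)"
    using assms by (intro nn_integral_cong_AE, eventually_elim) simp
  then show ?thesis
    by (simp add: E_energy_def nn_integral_Leb K_energy_cong_AE[OF assms])
qed

text \<open>Clamping a Borel version to the interval from -1 to 1 changes it only on a null set and
  makes the bound valid everywhere. Energies do not notice the change, by
  \<open>E_energy_cong_AE\<close>.\<close>

lemma minimizer_bdd_borel_representative:
  assumes u: "minimizer_bdd n s p W \<Omega> u"
  obtains u' where "u' \<in> borel_measurable (PiLeb n)" "AE x in PiLeb n. u x = u' x"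
    "\<And>x. \<bar>u' x\<bar> \<le> 1"
proof -
  from u have m: "u \<in> borel_measurable (Leb n)" and b: "AE x in PiLeb n. \<bar>u x\<bar> \<le> 1"
    by (simp_all add: minimizer_bdd_def X_space_def AE_Leb_iff)
  from completion_ex_borel_measurable_real[OF m[unfolded Leb_def]]
  obtain g where [measurable]: "g \<in> borel_measurable (PiLeb n)" and g: "AE x in PiLeb n. u x = g x"
    by auto
  show ?thesis
  proof
    show "(\<lambda>x. max (-1) (min 1 (g x))) \<in> borel_measurable (PiLeb n)" by measurable
    show "AE x in PiLeb n. u x = max (-1) (min 1 (g x))"
      using g b by eventually_elim auto
  qed auto
qed

subsection \<open>Truncation\<close>

text \<open>Mean value theorem, the derivative being at most \<open>p * B powr (p - 1)\<close>; for
  \<open>a \<le> b\<close> the left side is nonpositive.\<close>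

lemma abs_powr_diff_le:
  fixes a b :: real
  assumes p: "1 \<le> p" and a: "0 \<le> a" "a \<le> B" and b: "0 \<le> b" "b \<le> B"
  shows "a powr p - b powr p \<le> p * B powr (p - 1) * \<bar>a - b\<bar>"
proof (cases "b < a")
  case True
  have "continuous_on {b..a} (\<lambda>x. x powr p)"
    using b p by (intro continuous_on_powr' continuous_intros) auto
  moreover have "((\<lambda>x. x powr p) has_derivative (*) (p * x powr (p - 1))) (at x)" if "b < x" for x
    using that b has_real_derivative_powr[of x p] by (simp add: has_field_derivative_def)
  ultimately obtain z where z: "b < z" "z < a" "a powr p - b powr p = p * z powr (p - 1) * (a - b)"
    using mvt[OF True, of "\<lambda>x. x powr p" "\<lambda>x. (*) (p * x powr (p - 1))"] by blast
  have "z powr (p - 1) \<le> B powr (p - 1)"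
    using z a b p by (intro powr_mono2) auto
  then have "p * z powr (p - 1) * (a - b) \<le> p * B powr (p - 1) * (a - b)"
    using True p by (intro mult_right_mono mult_left_mono) auto
  with z True show ?thesis by (simp add: mult_ac)
next
  case False
  then have "a powr p \<le> b powr p" using a p by (intro powr_mono2) auto
  moreover have "0 \<le> p * B powr (p - 1) * \<bar>a - b\<bar>" using p by simp
  ultimately show ?thesis by linarith
qed

text \<open>Superadditivity of the power: divided by \<open>a powr p\<close>, it follows from
  \<open>t powr p \<le> t\<close> for the two numbers \<open>(a - b) / a\<close> and
  \<open>b / a\<close>, whose sum is 1.\<close>

lemma powr_diff_le_diff_powr:
  fixes a b :: real
  assumes p: "1 \<le> p" and "0 \<le> b" "b \<le> a"
  shows "(a - b) powr p \<le> a powr p - b powr p"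
proof (cases "a = 0")
  case False
  then have a: "0 < a" using assms by simp
  have *: "t powr p \<le> t" if "0 \<le> t" "t \<le> 1" for t :: real
    using powr_mono'[of 1 p t] that p by (cases "t = 0") auto
  have "((a - b) / a) powr p + (b / a) powr p \<le> (a - b) / a + b / a"
    using assms a by (intro add_mono *) auto
  also have "\<dots> = 1" using a by (simp add: field_simps)
  finally have "((a - b) powr p + b powr p) / a powr p \<le> 1"
    using assms a by (simp add: powr_divide add_divide_distrib)
  then show ?thesis using a by (simp add: field_simps)
qed (use assms in auto)

section \<open>Truncation of a pair of values and of the potential\<close>

lemma truncation_pair_inside:
  fixes a b c :: real
  assumes p: "1 \<le> p"
  shows "\<bar>min a c - min b c\<bar> powr p \<le> \<bar>a - b\<bar> powr p"
  using p by (intro powr_mono2) auto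

text \<open>The distance of the two values shrinks by \<open>a - c\<close> if
  \<open>b \<le> c\<close> and by \<open>a - b\<close> otherwise, in both cases by at least
  \<open>\<alpha> - \<beta>\<close>. Superadditivity turns this into a gain of its
  \<open>p\<close>-th power.\<close>

lemma truncation_pair_gain:
  fixes a b c \<alpha> \<beta> :: real
  assumes p: "1 \<le> p" and "c \<le> \<beta>" "\<beta> < \<alpha>" "\<alpha> < a" "b \<le> \<beta>"
  shows "\<bar>min a c - min b c\<bar> powr p + (\<alpha> - \<beta>) powr p \<le> \<bar>a - b\<bar> powr p"
proof -
  have c: "min a c = c" using assms by auto
  have "\<bar>c - min b c\<bar> powr p + (\<alpha> - \<beta>) powr p \<le> \<bar>c - min b c\<bar> powr p + (\<bar>a - b\<bar> - \<bar>c - min b c\<bar>) powr p"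
    using assms by (intro add_left_mono powr_mono2) (auto simp: min_def)
  also have "\<dots> \<le> \<bar>a - b\<bar> powr p"
    using powr_diff_le_diff_powr[of p "\<bar>c - min b c\<bar>" "\<bar>a - b\<bar>"] assms by (auto simp: min_def)
  finally show ?thesis by (simp add: c)
qed

text \<open>Only one value is truncated, as for a pair across the boundary of the ball. All
  distances are at most 2, which gives the Lipschitz constant, and the truncated value moves by
  \<open>max 0 (a - c)\<close>.\<close>

lemma truncation_pair_loss:
  fixes a b c :: real
  assumes p: "1 \<le> p" and "\<bar>a\<bar> \<le> 1" "\<bar>b\<bar> \<le> 1" "\<bar>c\<bar> \<le> 1"
  shows "\<bar>min a c - b\<bar> powr p \<le> \<bar>a - b\<bar> powr p + p * 2 powr (p - 1) * max 0 (a - c)"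
proof -
  have "\<bar>min a c - b\<bar> powr p - \<bar>a - b\<bar> powr p \<le> p * 2 powr (p - 1) * \<bar>\<bar>min a c - b\<bar> - \<bar>a - b\<bar>\<bar>"
    using assms by (intro abs_powr_diff_le) auto
  also have "\<dots> \<le> p * 2 powr (p - 1) * max 0 (a - c)"
    using p by (intro mult_left_mono) auto
  finally show ?thesis by simp
qed

text \<open>Mean value theorem: at the intermediate point \<open>1 + z\<close> exceeds
  \<open>h\<close>, so \<open>W' z\<close> is at least \<open>c1 * h powr (m - 1)\<close>.\<close>

lemma potential_truncation:
  fixes W W' :: "real \<Rightarrow> real"
  assumes W: "\<And>x. x \<in> {-1..1} \<Longrightarrow> (W has_real_derivative W' x) (at x within {-1..1})"
    and W': "\<And>x. -1 < x \<Longrightarrow> x < \<tau> \<Longrightarrow> c1 * \<bar>1 + x\<bar> powr (m - 1) \<le> W' x"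
    and "1 \<le> m" "0 \<le> c1" "0 < h" "\<tau> \<le> 1" "-1 + h \<le> b" "b \<le> \<tau>"
  shows "W (-1 + h) + c1 * h powr (m - 1) * (b - (-1 + h)) \<le> W b"
proof (cases "-1 + h = b")
  case False
  then have lt: "-1 + h < b" using assms by simp
  have "continuous_on {-1 + h..b} W"
    using assms by (intro continuous_on_subset[OF DERIV_continuous_on[of "{-1..1}" W W']] W) auto
  moreover have "(W has_derivative (*) (W' x)) (at x)" if "-1 + h < x" "x < b" for x
  proof -
    have "(W has_real_derivative W' x) (at x)"
      using W[of x] that assms by (simp add: at_within_Icc_at)
    then show ?thesis by (simp add: has_field_derivative_def)
  qed
  ultimately obtain z where z: "-1 + h < z" "z < b" "W b - W (-1 + h) = W' z * (b - (-1 + h))"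
    using mvt[OF lt, of W "\<lambda>x. (*) (W' x)"] by blast
  have "c1 * h powr (m - 1) \<le> c1 * \<bar>1 + z\<bar> powr (m - 1)"
    using z assms by (intro mult_left_mono powr_mono2) auto
  also have "\<dots> \<le> W' z" using z assms by (intro W') auto
  finally have "c1 * h powr (m - 1) * (b - (-1 + h)) \<le> W' z * (b - (-1 + h))"
    using lt by (intro mult_right_mono) auto
  with z(3) show ?thesis by linarith
qed simp

section \<open>Averaging over the radius\<close>

text \<open>If \<open>t < r\<close>, moving the singularity up to \<open>r\<close> only increases
  the integrand. What remains is the integral of \<open>R powr -a\<close> from 0 over a length of at
  most \<open>w\<close>, finite because \<open>a < 1\<close>; with \<open>a = s * p\<close> this is
  the condition that makes jumps affordable.\<close>

lemma nn_integral_singular_average_le: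
  fixes r w a t :: real
  assumes "0 < w" "0 < a" "a < 1"
  shows "(\<integral>\<^sup>+R. indicator {r..r + w} R * indicator {t<..} R * ennreal ((R - t) powr -a) \<partial>lborel)
     \<le> ennreal (w powr (1 - a) / (1 - a)) * indicator {..<r + w} t"
proof (cases "t < r + w")
  case True
  let ?b = "max r t"
  have "(\<integral>\<^sup>+R. indicator {r..r + w} R * indicator {t<..} R * ennreal ((R - t) powr -a) \<partial>lborel)
     \<le> (\<integral>\<^sup>+R. ennreal ((R - ?b) powr -a) * indicator {?b..r + w} R \<partial>lborel)"
  proof (rule nn_integral_mono_AE)
    \<comment> \<open>At \<open>R = ?b\<close> the right side is \<open>0 powr -a = 0\<close>, so
      this one point has to be excluded.\<close>
    have "AE R in lborel. R \<noteq> ?b" by (rule AE_lborel_singleton)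
    then show "AE R in lborel. indicator {r..r + w} R * indicator {t<..} R * ennreal ((R - t) powr -a)
       \<le> ennreal ((R - ?b) powr -a) * indicator {?b..r + w} R"
    proof eventually_elim
      case (elim R)
      have "(R - t) powr -a \<le> (R - ?b) powr -a" if "?b < R"
        using that assms by (intro powr_mono2') auto
      then show ?case using elim by (auto simp: indicator_def intro!: ennreal_leI)
    qed
  qed
  also have "\<dots> = (\<integral>\<^sup>+R. ennreal (R powr -a) * indicator {0..r + w - ?b} R \<partial>lborel)"
    by (subst nn_integral_real_affine[where c=1 and t="?b"])
      (auto intro!: nn_integral_cong split: split_indicator)
  also have "\<dots> = (\<integral>\<^sup>+R. ennreal (indicator {0..r + w - ?b} R * R powr -a) \<partial>lborel)"
    by (intro nn_integral_cong) (auto split: split_indicator)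
  also have "\<dots> = ennreal ((r + w - ?b) powr (-a + 1) / (-a + 1))"
    using assms True by (intro nn_integral_has_integral_lebesgue has_integral_powr_from_0) auto
  also have "\<dots> \<le> ennreal (w powr (1 - a) / (1 - a))"
    using assms True by (intro ennreal_leI) (auto intro!: divide_right_mono powr_mono2)
  finally show ?thesis using True by simp
next
  case False
  then have "indicator {r..r + w} R * indicator {t<..} R * ennreal ((R - t) powr -a) = 0" for R
    by (auto simp: indicator_def)
  then show ?thesis
    by (simp only: nn_integral_const mult_zero_left zero_le)
qed

text \<open>If every radius violated the bound, integrating over \<open>R\<close> would contradict Tonelli and
  the integrability of \<open>(R - |x|)^(-a)\<close> in \<open>R\<close>.\<close>

lemma good_radius:
  assumes [measurable]: "F \<in> borel_measurable (PiLeb n)"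
    and w: "0 < w" and a: "0 < a" "a < 1"
    and fin: "(\<integral>\<^sup>+x. indicator (ball_Rn n (r + w)) x * F x \<partial>PiLeb n) < \<infinity>"
  obtains R where "r \<le> R" "R \<le> r + w"
    "(\<integral>\<^sup>+x. indicator (ball_Rn n R) x * ennreal ((R - L2_set x {..<n}) powr -a) * F x \<partial>PiLeb n)
      \<le> ennreal (2 / (1 - a) * w powr -a) * (\<integral>\<^sup>+x. indicator (ball_Rn n (r + w)) x * F x \<partial>PiLeb n)"
proof -
  interpret pair_sigma_finite "PiLeb n" "lborel :: real measure"
    using sigma_finite_PiLeb lborel.sigma_finite_measure_axioms by (rule pair_sigma_finite.intro)
  let ?N = "\<lambda>x. L2_set x {..<n}"
  define I where "I = (\<integral>\<^sup>+x. indicator (ball_Rn n (r + w)) x * F x \<partial>PiLeb n)"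
  define f where "f R = (\<integral>\<^sup>+x. indicator (ball_Rn n R) x * ennreal ((R - ?N x) powr -a) * F x \<partial>PiLeb n)" for R
  \<comment> \<open>\<open>C\<close> is the integral of \<open>x powr -a\<close> over an interval of
    length \<open>w\<close> from 0; the factor in the claim is \<open>2 * C / w\<close>, twice the
    average.\<close>
  define C where "C = w powr (1 - a) / (1 - a)"
  have C: "0 < C" and Cw: "2 / (1 - a) * w powr -a * w = 2 * C"
    using w a by (auto simp: C_def powr_diff powr_minus field_simps)
  have "(\<integral>\<^sup>+R. indicator {r..r + w} R * f R \<partial>lborel)
     = (\<integral>\<^sup>+R. (\<integral>\<^sup>+x. indicator {r..r + w} R * indicator {?N x<..} R * ennreal ((R - ?N x) powr -a) * F x \<partial>PiLeb n) \<partial>lborel)"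
    unfolding f_def
    by (auto simp: nn_integral_cmult[symmetric] ball_Rn_def space_PiLeb intro!: nn_integral_cong split: split_indicator)
  also have "\<dots> = (\<integral>\<^sup>+x. (\<integral>\<^sup>+R. indicator {r..r + w} R * indicator {?N x<..} R * ennreal ((R - ?N x) powr -a) * F x \<partial>lborel) \<partial>PiLeb n)"
  proof (rule Fubini')
    have [measurable]: "(\<lambda>z. ?N (fst z)) \<in> borel_measurable (PiLeb n \<Otimes>\<^sub>M lborel)"
      by (rule measurable_compose[OF measurable_fst L2_set_measurable])
    have [measurable]: "(\<lambda>z. F (fst z)) \<in> borel_measurable (PiLeb n \<Otimes>\<^sub>M lborel)"
      by (rule measurable_compose[OF measurable_fst]) fact
    have [measurable]: "(\<lambda>z. snd z) \<in> borel_measurable (PiLeb n \<Otimes>\<^sub>M (lborel :: real measure))"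
      using measurable_snd[of "PiLeb n" "lborel :: real measure"] by simp
    have "(\<lambda>z. indicator {r..r + w} (snd z) * (if ?N (fst z) < snd z then 1 else 0)
        * ennreal ((snd z - ?N (fst z)) powr -a) * F (fst z)) \<in> borel_measurable (PiLeb n \<Otimes>\<^sub>M lborel)"
      by measurable
    then show "(\<lambda>(x, R). indicator {r..r + w} R * indicator {?N x<..} R * ennreal ((R - ?N x) powr -a) * F x)
        \<in> borel_measurable (PiLeb n \<Otimes>\<^sub>M lborel)"
      by (simp add: case_prod_beta' indicator_def of_bool_def cong: if_cong)
  qed
  also have "\<dots> = (\<integral>\<^sup>+x. (\<integral>\<^sup>+R. indicator {r..r + w} R * indicator {?N x<..} R * ennreal ((R - ?N x) powr -a) \<partial>lborel) * F x \<partial>PiLeb n)"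
    by (intro nn_integral_cong nn_integral_multc) measurable
  also have "\<dots> \<le> (\<integral>\<^sup>+x. ennreal C * (indicator (ball_Rn n (r + w)) x * F x) \<partial>PiLeb n)"
  proof (rule nn_integral_mono)
    fix x assume x: "x \<in> space (PiLeb n)"
    have "(\<integral>\<^sup>+R. indicator {r..r + w} R * indicator {?N x<..} R * ennreal ((R - ?N x) powr -a) \<partial>lborel) * F x
      \<le> (ennreal C * indicator {..<r + w} (?N x)) * F x"
      unfolding C_def using w a by (intro mult_right_mono nn_integral_singular_average_le) auto
    also have "indicator {..<r + w} (?N x) = (indicator (ball_Rn n (r + w)) x :: ennreal)"
      using x by (auto simp: ball_Rn_def space_PiLeb split: split_indicator)
    finally show "(\<integral>\<^sup>+R. indicator {r..r + w} R * indicator {?N x<..} R * ennreal ((R - ?N x) powr -a) \<partial>lborel) * F x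
      \<le> ennreal C * (indicator (ball_Rn n (r + w)) x * F x)" by (simp only: mult.assoc)
  qed
  also have "\<dots> = ennreal C * I"
    unfolding I_def by (intro nn_integral_cmult) measurable
  finally have avg: "(\<integral>\<^sup>+R. indicator {r..r + w} R * f R \<partial>lborel) \<le> ennreal C * I" .
  \<comment> \<open>For \<open>0 < I\<close> the factor 2 leads to
    \<open>2 * C * I \<le> C * I\<close>, which is absurd as \<open>I\<close> is finite. For
    \<open>I = 0\<close> this is no contradiction, but then \<open>F\<close> vanishes almost
    everywhere on the ball and the radius \<open>r + w\<close> works.\<close>
  have "\<exists>R\<in>{r..r + w}. f R \<le> ennreal (2 / (1 - a) * w powr -a) * I"
  proof (cases "I = 0")
    case True
    then have "AE x in PiLeb n. indicator (ball_Rn n (r + w)) x * F x = 0"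
      unfolding I_def by (subst (asm) nn_integral_0_iff_AE) auto
    then have "f (r + w) = (\<integral>\<^sup>+x. 0 \<partial>PiLeb n)"
      unfolding f_def by (intro nn_integral_cong_AE, eventually_elim) auto
    then show ?thesis using w by (intro bexI[of _ "r + w"]) auto
  next
    case False
    show ?thesis
    proof (rule ccontr)
      let ?L = "ennreal (2 / (1 - a) * w powr -a) * I"
      assume "\<not> ?thesis"
      then have *: "R \<in> {r..r + w} \<Longrightarrow> ?L \<le> f R" for R by (auto simp: not_le less_imp_le)
      have "ennreal (2 * C) = ennreal (2 / (1 - a) * w powr -a) * ennreal w"
        unfolding Cw[symmetric] using w a by (intro ennreal_mult) auto
      then have "ennreal (2 * C) * I = ?L * emeasure lborel {r..r + w}"
        using w by (simp add: mult_ac)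
      also have "\<dots> = (\<integral>\<^sup>+R. ?L * indicator {r..r + w} R \<partial>lborel)"
        by (subst nn_integral_cmult_indicator) auto
      also have "\<dots> \<le> (\<integral>\<^sup>+R. indicator {r..r + w} R * f R \<partial>lborel)"
        using * by (intro nn_integral_mono) (auto split: split_indicator)
      also note avg
      finally have le: "ennreal (2 * C) * I \<le> ennreal C * I" .
      obtain i where i: "I = ennreal i" "0 \<le> i"
        using fin unfolding I_def[symmetric] by (cases I) auto
      then have "0 < i" using False by auto
      with le C i show False
        by (simp add: ennreal_mult[symmetric])
    qed
  qed
  then show ?thesis
    using that unfolding I_def f_def by auto
qed

section \<open>Kinetic energy of a truncated function\<close>

text \<open>Brings both parts of the energy under one double integral, so that two energies can be
  compared through their integrands.\<close>

lemma K_energy_eq: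
  assumes [measurable]: "\<Omega> \<in> sets (PiLeb n)" "u \<in> borel_measurable (PiLeb n)"
  shows "K_energy n s p u \<Omega> = (\<integral>\<^sup>+y. (\<integral>\<^sup>+x. ennreal (indicator \<Omega> y * (indicator \<Omega> x / 2 + indicator (Rn n - \<Omega>) x) *
     \<bar>u x - u y\<bar> powr p * (1 / dist_Rn n x y powr (real n + s * p))) \<partial>PiLeb n) \<partial>PiLeb n)"
proof -
  interpret sigma_finite_measure "PiLeb n" by (rule sigma_finite_PiLeb)
  let ?k = "\<lambda>x y. \<bar>u x - u y\<bar> powr p / dist_Rn n x y powr (real n + s * p)"
  have "K_energy n s p u \<Omega> = (\<integral>\<^sup>+y. (\<integral>\<^sup>+x. ennreal (1/2 * indicator \<Omega> y * indicator \<Omega> x * ?k x y) \<partial>PiLeb n) \<partial>PiLeb n)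
     + (\<integral>\<^sup>+y. (\<integral>\<^sup>+x. ennreal (indicator \<Omega> y * indicator (Rn n - \<Omega>) x * ?k x y) \<partial>PiLeb n) \<partial>PiLeb n)"
  proof -
    have "1 / 2 * (\<integral>\<^sup>+y\<in>\<Omega>. (\<integral>\<^sup>+x\<in>\<Omega>. kernel_sp n s p u x y \<partial>PiLeb n) \<partial>PiLeb n)
      = (\<integral>\<^sup>+y. (\<integral>\<^sup>+x. ennreal (1/2 * indicator \<Omega> y * indicator \<Omega> x * ?k x y) \<partial>PiLeb n) \<partial>PiLeb n)"
    proof -
      have half: "1 / 2 * ennreal z = ennreal (1 / 2 * z)" for z
      proof -
        have "(1 / 2 :: ennreal) = ennreal (1 / 2)"
          by (subst divide_ennreal[symmetric]) auto
        then show ?thesis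
          using ennreal_mult'[of "1 / 2" z] by (simp only:)
      qed
      have "1 / 2 * (\<integral>\<^sup>+y\<in>\<Omega>. (\<integral>\<^sup>+x\<in>\<Omega>. kernel_sp n s p u x y \<partial>PiLeb n) \<partial>PiLeb n)
        = (\<integral>\<^sup>+y. 1 / 2 * ((\<integral>\<^sup>+x. kernel_sp n s p u x y * indicator \<Omega> x \<partial>PiLeb n) * indicator \<Omega> y) \<partial>PiLeb n)"
        unfolding kernel_sp_def by (rule nn_integral_cmult[symmetric]) measurable
      also have "\<dots> = (\<integral>\<^sup>+y. (\<integral>\<^sup>+x. ennreal (1/2 * indicator \<Omega> y * indicator \<Omega> x * ?k x y) \<partial>PiLeb n) \<partial>PiLeb n)"
      proof (intro nn_integral_cong)
        fix y assume [measurable]: "y \<in> space (PiLeb n)"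
        have "1 / 2 * ((\<integral>\<^sup>+x. kernel_sp n s p u x y * indicator \<Omega> x \<partial>PiLeb n) * indicator \<Omega> y)
          = (1 / 2 * indicator \<Omega> y) * (\<integral>\<^sup>+x. kernel_sp n s p u x y * indicator \<Omega> x \<partial>PiLeb n)"
          by (simp add: mult_ac)
        also have "\<dots> = (\<integral>\<^sup>+x. (1 / 2 * indicator \<Omega> y) * (kernel_sp n s p u x y * indicator \<Omega> x) \<partial>PiLeb n)"
          unfolding kernel_sp_def by (rule nn_integral_cmult[symmetric]) measurable
        also have "\<dots> = (\<integral>\<^sup>+x. ennreal (1/2 * indicator \<Omega> y * indicator \<Omega> x * ?k x y) \<partial>PiLeb n)"
        proof (rule nn_integral_cong)
          fix x
          have "1 / 2 * indicator \<Omega> y * (kernel_sp n s p u x y * indicator \<Omega> x)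
            = indicator \<Omega> y * indicator \<Omega> x * (1 / 2 * kernel_sp n s p u x y)"
            by (simp only: mult_ac)
          also have "\<dots> = indicator \<Omega> y * indicator \<Omega> x * ennreal (1 / 2 * ?k x y)"
            unfolding kernel_sp_def half ..
          also have "\<dots> = ennreal (1/2 * indicator \<Omega> y * indicator \<Omega> x * ?k x y)"
            by (simp split: split_indicator)
          finally show "1 / 2 * indicator \<Omega> y * (kernel_sp n s p u x y * indicator \<Omega> x)
            = ennreal (1/2 * indicator \<Omega> y * indicator \<Omega> x * ?k x y)" .
        qed
        finally show "1 / 2 * ((\<integral>\<^sup>+x. kernel_sp n s p u x y * indicator \<Omega> x \<partial>PiLeb n) * indicator \<Omega> y)
          = (\<integral>\<^sup>+x. ennreal (1/2 * indicator \<Omega> y * indicator \<Omega> x * ?k x y) \<partial>PiLeb n)" .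
      qed
      finally show ?thesis .
    qed
    moreover have "(\<integral>\<^sup>+y\<in>\<Omega>. (\<integral>\<^sup>+x\<in>Rn n - \<Omega>. kernel_sp n s p u x y \<partial>PiLeb n) \<partial>PiLeb n)
      = (\<integral>\<^sup>+y. (\<integral>\<^sup>+x. ennreal (indicator \<Omega> y * indicator (Rn n - \<Omega>) x * ?k x y) \<partial>PiLeb n) \<partial>PiLeb n)"
      by (intro nn_integral_cong) (auto simp: kernel_sp_def ennreal_indicator[symmetric] ennreal_mult'[symmetric] mult.commute split: split_indicator intro!: nn_integral_cong)
    ultimately show ?thesis
      by (simp add: K_energy_def nn_integral_Leb)
  qed
  also have "\<dots> = (\<integral>\<^sup>+y. (\<integral>\<^sup>+x. ennreal (1/2 * indicator \<Omega> y * indicator \<Omega> x * ?k x y) \<partial>PiLeb n)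
      + (\<integral>\<^sup>+x. ennreal (indicator \<Omega> y * indicator (Rn n - \<Omega>) x * ?k x y) \<partial>PiLeb n) \<partial>PiLeb n)"
    by (subst nn_integral_add) measurable
  also have "\<dots> = (\<integral>\<^sup>+y. (\<integral>\<^sup>+x. ennreal (indicator \<Omega> y * (indicator \<Omega> x / 2 + indicator (Rn n - \<Omega>) x) *
     \<bar>u x - u y\<bar> powr p * (1 / dist_Rn n x y powr (real n + s * p))) \<partial>PiLeb n) \<partial>PiLeb n)"
  proof (intro nn_integral_cong)
    fix y assume [measurable]: "y \<in> space (PiLeb n)"
    have "(\<integral>\<^sup>+x. ennreal (1/2 * indicator \<Omega> y * indicator \<Omega> x * ?k x y) \<partial>PiLeb n)
      + (\<integral>\<^sup>+x. ennreal (indicator \<Omega> y * indicator (Rn n - \<Omega>) x * ?k x y) \<partial>PiLeb n)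
      = (\<integral>\<^sup>+x. ennreal (1/2 * indicator \<Omega> y * indicator \<Omega> x * ?k x y) + ennreal (indicator \<Omega> y * indicator (Rn n - \<Omega>) x * ?k x y) \<partial>PiLeb n)"
      by (subst nn_integral_add) measurable
    also have "\<dots> = (\<integral>\<^sup>+x. ennreal (indicator \<Omega> y * (indicator \<Omega> x / 2 + indicator (Rn n - \<Omega>) x) *
     \<bar>u x - u y\<bar> powr p * (1 / dist_Rn n x y powr (real n + s * p))) \<partial>PiLeb n)"
      by (intro nn_integral_cong) (auto simp: ennreal_plus[symmetric] algebra_simps split: split_indicator simp del: ennreal_plus)
    finally show "(\<integral>\<^sup>+x. ennreal (1/2 * indicator \<Omega> y * indicator \<Omega> x * ?k x y) \<partial>PiLeb n)
      + (\<integral>\<^sup>+x. ennreal (indicator \<Omega> y * indicator (Rn n - \<Omega>) x * ?k x y) \<partial>PiLeb n)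
      = (\<integral>\<^sup>+x. ennreal (indicator \<Omega> y * (indicator \<Omega> x / 2 + indicator (Rn n - \<Omega>) x) *
     \<bar>u x - u y\<bar> powr p * (1 / dist_Rn n x y powr (real n + s * p))) \<partial>PiLeb n)" .
  qed
  finally show ?thesis .
qed


text \<open>Pairs inside \<open>B\<close> never cost energy, and they gain when they join
  \<open>P\<close> to \<open>N\<close>. Pairs with exactly one point in \<open>B\<close> lose at
  most a multiple of the excess over \<open>c\<close> at that point. All other pairs are
  unchanged.\<close>

lemma K_energy_truncation_le:
  fixes u :: "(nat \<Rightarrow> real) \<Rightarrow> real" and s p c \<alpha> \<beta> :: real
  assumes [measurable]: "\<Omega> \<in> sets (PiLeb n)" "B \<in> sets (PiLeb n)" "u \<in> borel_measurable (PiLeb n)"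
      "P \<in> sets (PiLeb n)" "N \<in> sets (PiLeb n)"
    and sub: "B \<subseteq> \<Omega>" "P \<subseteq> B" "N \<subseteq> B"
    and p: "1 \<le> p" and u: "\<And>x. \<bar>u x\<bar> \<le> 1" and c: "\<bar>c\<bar> \<le> 1"
    and PN: "\<And>x. x \<in> P \<Longrightarrow> \<alpha> < u x" "\<And>x. x \<in> N \<Longrightarrow> u x \<le> \<beta>" and ab: "c \<le> \<beta>" "\<beta> < \<alpha>"
  defines "v \<equiv> \<lambda>x. if x \<in> B then min (u x) c else u x"
    and "k \<equiv> \<lambda>x y. 1 / dist_Rn n x y powr (real n + s * p)"
  shows "K_energy n s p v \<Omega> +
      ennreal ((\<alpha> - \<beta>) powr p / 2) * (\<integral>\<^sup>+y. indicator P y * (\<integral>\<^sup>+x. indicator N x * ennreal (k x y) \<partial>PiLeb n) \<partial>PiLeb n)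
    \<le> K_energy n s p u \<Omega> +
      ennreal (p * 2 powr p) * (\<integral>\<^sup>+y. indicator B y * ennreal (max 0 (u y - c)) *
        (\<integral>\<^sup>+x. indicator (Rn n - B) x * ennreal (k x y) \<partial>PiLeb n) \<partial>PiLeb n)"
proof -
  interpret sigma_finite_measure "PiLeb n" by (rule sigma_finite_PiLeb)
  interpret pair_sigma_finite "PiLeb n" "PiLeb n" ..
  have v [measurable]: "v \<in> borel_measurable (PiLeb n)" unfolding v_def by measurable
  have k0: "0 \<le> k x y" for x y by (simp add: k_def)
  have km: "(\<lambda>z. k (f z) (g z)) \<in> borel_measurable L" if [measurable]: "f \<in> measurable L (PiLeb n)" "g \<in> measurable L (PiLeb n)" for f g L
    unfolding k_def by measurable
  note [measurable] = km
  define \<omega> :: "_ \<Rightarrow> _ \<Rightarrow> real" where "\<omega> x y = indicator \<Omega> y * (indicator \<Omega> x / 2 + indicator (Rn n - \<Omega>) x)" for x y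
  have \<omega>m [measurable]: "(\<lambda>z. \<omega> (f z) (g z)) \<in> borel_measurable L" if [measurable]: "f \<in> measurable L (PiLeb n)" "g \<in> measurable L (PiLeb n)" for f g L
    unfolding \<omega>_def by measurable
  define G where "G = (\<alpha> - \<beta>) powr p / 2"
  define l where "l = p * 2 powr (p - 1)"
  define \<phi> where "\<phi> y = max 0 (u y - c)" for y
  have [measurable]: "\<phi> \<in> borel_measurable (PiLeb n)" unfolding \<phi>_def by measurable
  have pos: "0 \<le> G" "0 \<le> l" "\<And>y. 0 \<le> \<phi> y" "\<And>x y. 0 \<le> \<omega> x y"
    using p by (auto simp: G_def l_def \<phi>_def \<omega>_def)
  \<comment> \<open>The two loss terms belong to the crossing pairs with \<open>y\<close> in
    \<open>B\<close> and with \<open>x\<close> in \<open>B\<close>. The factor 1/2 in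
    \<open>G\<close> is the weight of pairs inside \<Omega>.\<close>
  have pw: "\<omega> x y * \<bar>v x - v y\<bar> powr p * k x y + G * (indicator P y * (indicator N x * k x y))
     \<le> \<omega> x y * \<bar>u x - u y\<bar> powr p * k x y + (l * (indicator B y * \<phi> y * (indicator (Rn n - B) x * k x y))
        + l * (indicator B x * \<phi> x * (indicator (Rn n - B) y * k x y)))"
    if x: "x \<in> Rn n" and y: "y \<in> Rn n" for x y
  proof -
    \<comment> \<open>The comparison is made without the kernel, which is nonnegative and is
      multiplied in afterwards.\<close>
    have "\<omega> x y * \<bar>v x - v y\<bar> powr p + G * (indicator P y * indicator N x)
     \<le> \<omega> x y * \<bar>u x - u y\<bar> powr p + (l * (indicator B y * \<phi> y * indicator (Rn n - B) x)
        + l * (indicator B x * \<phi> x * indicator (Rn n - B) y))"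
    proof (cases "x \<in> B"; cases "y \<in> B")
      assume xB: "x \<in> B" and yB: "y \<in> B"
      then have "x \<in> \<Omega>" "y \<in> \<Omega>" using sub by auto
      then have w: "\<omega> x y = 1 / 2" by (simp add: \<omega>_def)
      show ?thesis
      proof (cases "y \<in> P \<and> x \<in> N")
        case True
        then have "\<bar>min (u y) c - min (u x) c\<bar> powr p + (\<alpha> - \<beta>) powr p \<le> \<bar>u y - u x\<bar> powr p"
          using PN ab p by (intro truncation_pair_gain) auto
        then show ?thesis
          unfolding w using True xB yB by (simp add: v_def G_def abs_minus_commute)
      next
        case False
        then show ?thesis
          unfolding w using xB yB truncation_pair_inside[OF p, of "u x" c "u y"] by (auto simp: v_def split: split_indicator)
      qed
    next
      assume xB: "x \<in> B" and yB: "y \<notin> B"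
      then have w: "\<omega> x y \<le> 1" "y \<notin> P" using sub by (auto simp: \<omega>_def split: split_indicator)
      have "\<omega> x y * \<bar>min (u x) c - u y\<bar> powr p \<le> \<omega> x y * (\<bar>u x - u y\<bar> powr p + l * \<phi> x)"
        unfolding l_def \<phi>_def using p u c pos by (intro mult_left_mono truncation_pair_loss) auto
      also have "\<dots> \<le> \<omega> x y * \<bar>u x - u y\<bar> powr p + l * \<phi> x"
        using mult_right_mono[OF w(1), of "l * \<phi> x"] pos by (simp add: algebra_simps)
      finally show ?thesis using xB yB w y by (simp add: v_def)
    next
      assume xB: "x \<notin> B" and yB: "y \<in> B"
      then have w: "\<omega> x y \<le> 1" "x \<notin> N" using sub by (auto simp: \<omega>_def split: split_indicator)
      have "\<omega> x y * \<bar>min (u y) c - u x\<bar> powr p \<le> \<omega> x y * (\<bar>u y - u x\<bar> powr p + l * \<phi> y)"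
        unfolding l_def \<phi>_def using p u c pos by (intro mult_left_mono truncation_pair_loss) auto
      also have "\<dots> \<le> \<omega> x y * \<bar>u y - u x\<bar> powr p + l * \<phi> y"
        using mult_right_mono[OF w(1), of "l * \<phi> y"] pos by (simp add: algebra_simps)
      finally show ?thesis using xB yB w x by (simp add: v_def abs_minus_commute)
    next
      assume xB: "x \<notin> B" and yB: "y \<notin> B"
      then have "y \<notin> P" using sub by auto
      with xB yB show ?thesis by (simp add: v_def)
    qed
    from mult_right_mono[OF this k0[of x y]] show ?thesis
      by (simp add: algebra_simps)
  qed
  let ?I = "\<lambda>F. \<integral>\<^sup>+y. (\<integral>\<^sup>+x. F x y \<partial>PiLeb n) \<partial>PiLeb n"
  have I_add: "?I (\<lambda>x y. F x y + F' x y) = ?I F + ?I F'"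
    if [measurable]: "(\<lambda>(x, y). F x y) \<in> borel_measurable (PiLeb n \<Otimes>\<^sub>M PiLeb n)"
      "(\<lambda>(x, y). F' x y) \<in> borel_measurable (PiLeb n \<Otimes>\<^sub>M PiLeb n)" for F F'
  proof -
    have "?I (\<lambda>x y. F x y + F' x y) = (\<integral>\<^sup>+y. (\<integral>\<^sup>+x. F x y \<partial>PiLeb n) + (\<integral>\<^sup>+x. F' x y \<partial>PiLeb n) \<partial>PiLeb n)"
      by (intro nn_integral_cong nn_integral_add) measurable
    then show ?thesis by (simp add: nn_integral_add)
  qed
  define D where "D w x y = ennreal (\<omega> x y * \<bar>w x - w y\<bar> powr p * k x y)" for w :: "(nat \<Rightarrow> real) \<Rightarrow> real" and x y
  define g where "g x y = ennreal (G * (indicator P y * (indicator N x * k x y)))" for x y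
  define L where "L x y = ennreal (l * (indicator B y * \<phi> y * (indicator (Rn n - B) x * k x y)))" for x y
  have [measurable]: "(\<lambda>(x, y). D u x y) \<in> borel_measurable (PiLeb n \<Otimes>\<^sub>M PiLeb n)"
    "(\<lambda>(x, y). D v x y) \<in> borel_measurable (PiLeb n \<Otimes>\<^sub>M PiLeb n)"
    "(\<lambda>(x, y). g x y) \<in> borel_measurable (PiLeb n \<Otimes>\<^sub>M PiLeb n)"
    "(\<lambda>(x, y). L x y) \<in> borel_measurable (PiLeb n \<Otimes>\<^sub>M PiLeb n)"
    "(\<lambda>(x, y). L y x) \<in> borel_measurable (PiLeb n \<Otimes>\<^sub>M PiLeb n)"
    unfolding D_def g_def L_def by measurable
  have KE: "K_energy n s p w \<Omega> = ?I (D w)" if [measurable]: "w \<in> borel_measurable (PiLeb n)" for w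
    unfolding D_def \<omega>_def k_def by (rule K_energy_eq) measurable
  have Ig: "?I g = ennreal G * (\<integral>\<^sup>+y. indicator P y * (\<integral>\<^sup>+x. indicator N x * ennreal (k x y) \<partial>PiLeb n) \<partial>PiLeb n)"
  proof -
    have "(\<integral>\<^sup>+x. g x y \<partial>PiLeb n) = ennreal G * (indicator P y * (\<integral>\<^sup>+x. indicator N x * ennreal (k x y) \<partial>PiLeb n))"
      if [measurable]: "y \<in> space (PiLeb n)" for y
    proof -
      have "(\<integral>\<^sup>+x. g x y \<partial>PiLeb n) = (\<integral>\<^sup>+x. ennreal G * (indicator P y * (indicator N x * ennreal (k x y))) \<partial>PiLeb n)"
        unfolding g_def using pos k0
        by (intro nn_integral_cong) (auto simp: ennreal_mult split: split_indicator)
      also have "\<dots> = ennreal G * (indicator P y * (\<integral>\<^sup>+x. indicator N x * ennreal (k x y) \<partial>PiLeb n))"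
        by (simp add: nn_integral_cmult)
      finally show ?thesis .
    qed
    then have "?I g = (\<integral>\<^sup>+y. ennreal G * (indicator P y * (\<integral>\<^sup>+x. indicator N x * ennreal (k x y) \<partial>PiLeb n)) \<partial>PiLeb n)"
      by (intro nn_integral_cong) auto
    then show ?thesis
      by (simp add: nn_integral_cmult)
  qed
  have IL: "?I L = ennreal l * (\<integral>\<^sup>+y. indicator B y * ennreal (\<phi> y) *
        (\<integral>\<^sup>+x. indicator (Rn n - B) x * ennreal (k x y) \<partial>PiLeb n) \<partial>PiLeb n)"
  proof -
    have "(\<integral>\<^sup>+x. L x y \<partial>PiLeb n) = ennreal l * (indicator B y * ennreal (\<phi> y) * (\<integral>\<^sup>+x. indicator (Rn n - B) x * ennreal (k x y) \<partial>PiLeb n))"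
      if [measurable]: "y \<in> space (PiLeb n)" for y
    proof -
      have "(\<integral>\<^sup>+x. L x y \<partial>PiLeb n) = (\<integral>\<^sup>+x. ennreal l * (indicator B y * ennreal (\<phi> y) * (indicator (Rn n - B) x * ennreal (k x y))) \<partial>PiLeb n)"
        unfolding L_def using pos k0
        by (intro nn_integral_cong) (auto simp: ennreal_mult split: split_indicator)
      also have "\<dots> = ennreal l * (indicator B y * ennreal (\<phi> y) * (\<integral>\<^sup>+x. indicator (Rn n - B) x * ennreal (k x y) \<partial>PiLeb n))"
        by (simp add: nn_integral_cmult)
      finally show ?thesis .
    qed
    then have "?I L = (\<integral>\<^sup>+y. ennreal l * (indicator B y * ennreal (\<phi> y) * (\<integral>\<^sup>+x. indicator (Rn n - B) x * ennreal (k x y) \<partial>PiLeb n)) \<partial>PiLeb n)"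
      by (intro nn_integral_cong) auto
    then show ?thesis
      by (simp add: nn_integral_cmult)
  qed
  \<comment> \<open>By Tonelli both kinds of crossing pairs lose the same amount, which turns
    \<open>l\<close> into \<open>p * 2 powr p\<close>.\<close>
  have ILs: "?I (\<lambda>x y. L y x) = ?I L"
    by (rule Fubini') measurable
  have "K_energy n s p v \<Omega> + ?I g = ?I (\<lambda>x y. D v x y + g x y)"
    unfolding KE[OF v] by (rule I_add[symmetric]) measurable
  also have "\<dots> \<le> ?I (\<lambda>x y. D u x y + (L x y + L y x))"
  proof (intro nn_integral_mono)
    fix x y assume "x \<in> space (PiLeb n)" "y \<in> space (PiLeb n)"
    then have "x \<in> Rn n" "y \<in> Rn n" by (simp_all add: space_PiLeb)
    from ennreal_leI[OF pw[OF this]]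
    show "D v x y + g x y \<le> D u x y + (L x y + L y x)"
      unfolding D_def g_def L_def using pos k0
      by (simp add: ennreal_plus[symmetric] k_def dist_Rn_sym[of n y x] del: ennreal_plus)
  qed
  also have "\<dots> = ?I (D u) + (?I L + ?I L)"
    by (simp add: I_add ILs)
  also have "?I L + ?I L = ennreal (p * 2 powr p) * (\<integral>\<^sup>+y. indicator B y * ennreal (\<phi> y) *
        (\<integral>\<^sup>+x. indicator (Rn n - B) x * ennreal (k x y) \<partial>PiLeb n) \<partial>PiLeb n)"
  proof -
    have "p * 2 powr p = l + l" by (simp add: l_def powr_diff)
    then have "ennreal (p * 2 powr p) = ennreal l + ennreal l"
      using pos by (simp only: ennreal_plus)
    then show ?thesis unfolding IL by (simp only: distrib_right)
  qed
  finally show ?thesis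
    unfolding Ig KE[OF assms(3)] G_def \<phi>_def .
qed

section \<open>Choice of the parameters\<close>

text \<open>\<open>(1 / 2) ^ K\<close> will be the density to propagate and \<open>t\<close> the
  relative half-side of a cube of which the exceptional set fills at most half. The equation for
  \<open>t\<close> forces \<open>t = E * q ^ K\<close> with \<open>q ^ n = 1 / 2\<close>. Hence
  \<open>t powr -a\<close> grows exponentially in \<open>K\<close> and beats
  \<open>A * real K\<close>, while \<open>(1 / 2) ^ K * (real K * w) ^ n\<close> tends to 0; every
  large \<open>K\<close> will do.\<close>

lemma geometric_parameters_exist:
  fixes a A c C d r w :: real and n :: nat
  assumes n: "1 \<le> n" and a: "0 < a" and c: "0 < c" and C: "0 < C" and d: "0 < d" and w: "0 < w"
  obtains K :: nat and t :: real where "1 \<le> K" "0 < t" "real n * t \<le> 1" "C * (1 / 2) ^ K = (2 * t) ^ n / 2"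
    "A * real K < c * t powr -a" "(1 / 2) ^ K * (real K * w) ^ n \<le> d" "r \<le> real K * w"
proof -
  define q where "q = 2 powr (- 1 / real n)"
  have q: "0 < q" "q < 1" using n by (auto simp: q_def powr_less_one)
  have qn: "(q ^ K) ^ n = (1 / 2) ^ K" for K
  proof -
    have "q ^ n = 1 / 2"
      using n unfolding q_def by (subst powr_power) (simp_all add: powr_minus)
    then show ?thesis
      by (simp only: power_mult[symmetric] mult.commute[of K n]) (simp only: power_mult)
  qed
  define E where "E = (2 * C) powr (1 / real n) / 2"
  have E: "0 < E" using C by (simp add: E_def)
  have En: "(2 * E) ^ n = 2 * C"
    using n C by (simp add: E_def powr_power)
  have t0: "(\<lambda>K. real n * (E * q ^ K)) \<longlonglongrightarrow> real n * (E * 0)"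
    using q by (intro tendsto_intros LIMSEQ_power_zero) auto
  have ev1: "\<forall>\<^sub>F K in sequentially. real n * (E * q ^ K) < 1"
    using order_tendstoD(2)[OF t0, of 1] by simp
  have qa: "0 < q powr a" "q powr a < 1"
    using n a by (auto simp: q_def powr_powr intro!: powr_less_one divide_neg_pos)
  have "(\<lambda>K. A * (real K * (q powr a) ^ K)) \<longlonglongrightarrow> A * 0"
    using qa by (intro tendsto_intros powser_times_n_limit_0) auto
  \<comment> \<open>The bound on \<open>A * real K\<close>, multiplied by
    \<open>(q powr a) ^ K\<close>: now the left side tends to 0 and the right side is
    constant.\<close>
  then have ev2: "\<forall>\<^sub>F K in sequentially. A * (real K * (q powr a) ^ K) < c * E powr -a"
    using c E by (intro order_tendstoD) auto
  have "(\<lambda>K. (w * (real K * q ^ K)) ^ n) \<longlonglongrightarrow> (w * 0) ^ n"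
    using q by (intro tendsto_intros powser_times_n_limit_0) auto
  moreover have "(w * 0) ^ n < d"
    using d n by (simp add: power_0_left)
  ultimately have ev3: "\<forall>\<^sub>F K in sequentially. (w * (real K * q ^ K)) ^ n < d"
    by (rule order_tendstoD)
  have ev4: "\<forall>\<^sub>F K in sequentially. r / w \<le> real K"
    using filterlim_real_sequentially by (simp add: filterlim_at_top)
  have "\<forall>\<^sub>F K in sequentially. 1 \<le> K" by (rule eventually_ge_at_top)
  then have "\<forall>\<^sub>F K in sequentially. 1 \<le> K \<and> real n * (E * q ^ K) < 1 \<and> A * (real K * (q powr a) ^ K) < c * E powr -a
     \<and> (w * (real K * q ^ K)) ^ n < d \<and> r / w \<le> real K"
    using ev1 ev2 ev3 ev4 by eventually_elim auto
  then obtain K where K: "1 \<le> K" "real n * (E * q ^ K) < 1" "A * (real K * (q powr a) ^ K) < c * E powr -a"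
     "(w * (real K * q ^ K)) ^ n < d" "r / w \<le> real K"
    by (auto dest!: eventually_happens)
  show ?thesis
  proof
    show "1 \<le> K" by fact
    show "0 < E * q ^ K" using E q by simp
    show "real n * (E * q ^ K) \<le> 1" using K by simp
    have "(2 * (E * q ^ K)) ^ n = (2 * E) ^ n * (q ^ K) ^ n"
      by (simp only: power_mult_distrib mult.assoc)
    then show "C * (1 / 2) ^ K = (2 * (E * q ^ K)) ^ n / 2"
      unfolding En qn by simp
    have "(q ^ K) powr a = (q powr a) ^ K"
      using q by (simp add: powr_power powr_realpow[symmetric] powr_powr mult.commute)
    then have "(E * q ^ K) powr -a = E powr -a * (1 / (q powr a) ^ K)"
      using E q by (simp add: powr_mult powr_minus divide_inverse)
    moreover have "0 < (q powr a) ^ K" using qa by simp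
    ultimately show "A * real K < c * (E * q ^ K) powr -a"
      using K(3) by (simp only: times_divide_eq_right mult_1_right pos_less_divide_eq mult.assoc)
    have "(1 / 2) ^ K * (real K * w) ^ n = (w * (real K * q ^ K)) ^ n"
      unfolding qn[symmetric] by (simp add: power_mult_distrib mult_ac)
    then show "(1 / 2) ^ K * (real K * w) ^ n \<le> d" using K(4) by simp
    show "r \<le> real K * w" using K(5) w by (simp add: field_simps)
  qed
qed

subsection \<open>Minimizers under truncation\<close>

definition truncate :: "nat \<Rightarrow> real \<Rightarrow> real \<Rightarrow> ((nat \<Rightarrow> real) \<Rightarrow> real) \<Rightarrow> (nat \<Rightarrow> real) \<Rightarrow> real" where
  "truncate n R c u x = (if x \<in> ball_Rn n R then min (u x) c else u x)"

text \<open>The factors come from \<open>K_energy_truncation_le\<close>,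
  \<open>kernel_tail_le\<close> and \<open>good_radius\<close>. Multiplied by
  \<open>w powr - (s * p)\<close>, this bounds the energy lost per unit of excess when the radius is
  averaged over a width \<open>w\<close>.\<close>

definition tail_const :: "nat \<Rightarrow> real \<Rightarrow> real \<Rightarrow> real" where
  "tail_const n s p = p * 2 powr p * (4 ^ n / (1 - 2 powr - (s * p))) * (2 / (1 - s * p))"

lemma tail_const_pos:
  assumes "0 < p" "0 < s * p" "s * p < 1"
  shows "0 < tail_const n s p"
  using assms by (simp add: tail_const_def powr_less_one)

text \<open>The setting of the comparison argument: a Borel function bounded everywhere, a domain of
  finite volume, and minimality against truncations on balls. \<open>\<tau>\<close> stands for
  \<open>\<theta>min\<close>; the growth of \<open>W'\<close> is required only below it.\<close>

locale truncation_minimizer =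
  fixes n :: nat and s p m Lam c1 \<tau> :: real and W W' :: "real \<Rightarrow> real"
    and \<Omega> :: "(nat \<Rightarrow> real) set" and u :: "(nat \<Rightarrow> real) \<Rightarrow> real"
  assumes n: "1 \<le> n" and p: "1 < p" and s: "0 < s * p" "s * p < 1" and m: "1 < m"
    and W_deriv: "\<And>x. x \<in> {-1..1} \<Longrightarrow> (W has_real_derivative W' x) (at x within {-1..1})"
    and W_nonneg: "\<And>x. x \<in> {-1..1} \<Longrightarrow> 0 \<le> W x"
    and W_le: "\<And>x. x \<in> {-1..1} \<Longrightarrow> W x \<le> Lam * \<bar>1 + x\<bar> powr m"
    and W'_ge: "\<And>x. -1 < x \<Longrightarrow> x < \<tau> \<Longrightarrow> c1 * \<bar>1 + x\<bar> powr (m - 1) \<le> W' x"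
    and Lam: "0 \<le> Lam" and c1: "0 < c1" and tau: "-1 < \<tau>" "\<tau> < 0"
    and \<Omega> [measurable]: "\<Omega> \<in> sets (PiLeb n)" and \<Omega>_fin: "emeasure (PiLeb n) \<Omega> < \<infinity>"
    and u_meas [measurable]: "u \<in> borel_measurable (PiLeb n)" and u_bdd: "\<And>x. \<bar>u x\<bar> \<le> 1"
    and K_fin: "K_energy n s p u \<Omega> < \<infinity>"
    and minimal: "\<And>R c. ball_Rn n R \<subseteq> \<Omega> \<Longrightarrow> \<bar>c\<bar> \<le> 1 \<Longrightarrow> K_energy n s p (truncate n R c u) \<Omega> < \<infinity> \<Longrightarrow>
        E_energy n s p W u \<Omega> \<le> E_energy n s p W (truncate n R c u) \<Omega>"
begin

section \<open>Excess, superlevel volume and interaction\<close>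

definition excess :: "real \<Rightarrow> (nat \<Rightarrow> real) \<Rightarrow> real" where
  "excess h x = max 0 (u x - (-1 + h))"

text \<open>The quantity \<Phi>(r) at the level \<open>h\<close>, restricted to the values for which
  the growth of the potential is known.\<close>

definition low_excess :: "real \<Rightarrow> real \<Rightarrow> ennreal" where
  "low_excess h r = (\<integral>\<^sup>+x. indicator {x \<in> ball_Rn n r. u x \<le> \<tau>} x * ennreal (excess h x) \<partial>PiLeb n)"

definition high_volume :: "real \<Rightarrow> ennreal" where
  "high_volume r = emeasure (PiLeb n) {x \<in> ball_Rn n r. \<tau> < u x}"

text \<open>Only the kernel is integrated: between the levels U = \<Theta> and U = \<Theta>/2 the
  truncation gains at least a fixed power of \<open>(1 + \<tau>) / 2\<close> per pair.\<close>

definition interaction :: "real \<Rightarrow> ennreal" where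
  "interaction r = (\<integral>\<^sup>+y. indicator {y \<in> ball_Rn n r. \<tau> < u y} y *
     (\<integral>\<^sup>+x. indicator {x \<in> ball_Rn n r. u x \<le> -1 + (1 + \<tau>) / 2} x *
        ennreal (1 / dist_Rn n x y powr (real n + s * p)) \<partial>PiLeb n) \<partial>PiLeb n)"

lemma excess_nonneg [simp]: "0 \<le> excess h x"
  by (simp add: excess_def)

lemma excess_measurable [measurable]: "excess h \<in> borel_measurable (PiLeb n)"
  unfolding excess_def by measurable

lemma level_sets_measurable [measurable]:
  "{x \<in> ball_Rn n r. \<tau> < u x} \<in> sets (PiLeb n)"
  "{x \<in> ball_Rn n r. u x \<le> t} \<in> sets (PiLeb n)"
proof -
  have "{x \<in> ball_Rn n r. \<tau> < u x} = {x \<in> space (PiLeb n). x \<in> ball_Rn n r \<and> \<tau> < u x}"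
    "{x \<in> ball_Rn n r. u x \<le> t} = {x \<in> space (PiLeb n). x \<in> ball_Rn n r \<and> u x \<le> t}"
    by (auto simp: ball_Rn_def space_PiLeb)
  then show "{x \<in> ball_Rn n r. \<tau> < u x} \<in> sets (PiLeb n)" "{x \<in> ball_Rn n r. u x \<le> t} \<in> sets (PiLeb n)"
    by simp_all
qed

lemma emeasure_ball_Rn_finite: "emeasure (PiLeb n) (ball_Rn n r) < \<infinity>"
proof (cases "0 \<le> r")
  case True
  from emeasure_ball_Rn_le[OF this, of n] ennreal_less_top show ?thesis
    unfolding infinity_ennreal_def by (rule le_less_trans)
next
  case False
  then have "\<not> L2_set x {..<n} < r" for x
    using L2_set_nonneg[of x "{..<n}"] by linarith
  then have "ball_Rn n r = {}"
    unfolding ball_Rn_def by blast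
  then show ?thesis by simp
qed

lemma high_volume_finite: "high_volume r < \<infinity>"
proof -
  have "high_volume r \<le> emeasure (PiLeb n) (ball_Rn n r)"
    unfolding high_volume_def by (intro emeasure_mono) auto
  then show ?thesis using emeasure_ball_Rn_finite[of r] by (rule le_less_trans)
qed

lemma high_volume_mono: "r \<le> r' \<Longrightarrow> high_volume r \<le> high_volume r'"
  unfolding high_volume_def using ball_Rn_mono[of r r' n] by (intro emeasure_mono) auto

lemma low_excess_mono: "r \<le> r' \<Longrightarrow> low_excess h r \<le> low_excess h r'"
  unfolding low_excess_def using ball_Rn_mono[of r r' n]
  by (intro nn_integral_mono mult_right_mono) (auto split: split_indicator)

text \<open>Above \<open>\<tau>\<close> the potential gives no control, and the excess is estimated
  by 2.\<close>

lemma total_excess_le: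
  assumes "0 < h"
  shows "(\<integral>\<^sup>+x. indicator (ball_Rn n r) x * ennreal (excess h x) \<partial>PiLeb n) \<le> low_excess h r + 2 * high_volume r"
proof -
  have "(\<integral>\<^sup>+x. indicator (ball_Rn n r) x * ennreal (excess h x) \<partial>PiLeb n)
    \<le> (\<integral>\<^sup>+x. indicator {x \<in> ball_Rn n r. u x \<le> \<tau>} x * ennreal (excess h x) + 2 * indicator {x \<in> ball_Rn n r. \<tau> < u x} x \<partial>PiLeb n)"
  proof (rule nn_integral_mono)
    fix x
    have "ennreal (excess h x) \<le> ennreal 2"
      using u_bdd[of x] assms by (intro ennreal_leI) (auto simp: excess_def)
    then show "indicator (ball_Rn n r) x * ennreal (excess h x)
      \<le> indicator {x \<in> ball_Rn n r. u x \<le> \<tau>} x * ennreal (excess h x) + 2 * indicator {x \<in> ball_Rn n r. \<tau> < u x} x"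
      by (auto split: split_indicator)
  qed
  also have "\<dots> = low_excess h r + 2 * high_volume r"
    unfolding low_excess_def high_volume_def
    by (subst nn_integral_add) (auto simp: nn_integral_cmult_indicator)
  finally show ?thesis .
qed

lemma total_excess_finite:
  assumes "0 < h"
  shows "(\<integral>\<^sup>+x. indicator (ball_Rn n r) x * ennreal (excess h x) \<partial>PiLeb n) < \<infinity>"
proof -
  have "(\<integral>\<^sup>+x. indicator (ball_Rn n r) x * ennreal (excess h x) \<partial>PiLeb n)
    \<le> (\<integral>\<^sup>+x. 2 * indicator (ball_Rn n r) x \<partial>PiLeb n)"
  proof (rule nn_integral_mono)
    fix x
    have "ennreal (excess h x) \<le> ennreal 2"
      using u_bdd[of x] assms by (intro ennreal_leI) (auto simp: excess_def)
    then show "indicator (ball_Rn n r) x * ennreal (excess h x) \<le> 2 * indicator (ball_Rn n r) x"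
      by (auto split: split_indicator)
  qed
  also have "\<dots> = 2 * emeasure (PiLeb n) (ball_Rn n r)"
    by (rule nn_integral_cmult_indicator) simp
  also have "\<dots> < \<infinity>"
    using emeasure_ball_Rn_finite[of r] by (simp add: ennreal_mult_less_top)
  finally show ?thesis .
qed

text \<open>\<open>W\<close> is arbitrary off the interval from -1 to 1; composed with the
  projection onto it, it is continuous on the line.\<close>

lemma W_measurable:
  assumes [measurable]: "v \<in> borel_measurable (PiLeb n)" and v: "\<And>x. \<bar>v x\<bar> \<le> 1"
  shows "(\<lambda>x. W (v x)) \<in> borel_measurable (PiLeb n)"
proof -
  have "continuous_on {-1..1} W"
    using W_deriv by (rule DERIV_continuous_on)
  then have "continuous_on UNIV (\<lambda>t. W (max (-1) (min 1 t)))"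
    by (rule continuous_on_compose2) (auto intro!: continuous_intros)
  then have [measurable]: "(\<lambda>t. W (max (-1) (min 1 t))) \<in> borel_measurable borel"
    by (rule borel_measurable_continuous_onI)
  have "(\<lambda>x. W (max (-1) (min 1 (v x)))) \<in> borel_measurable (PiLeb n)"
    by measurable
  moreover have "max (-1) (min 1 (v x)) = v x" for x
    using v[of x] by auto
  ultimately show ?thesis by simp
qed

text \<open>Finiteness allows the energy of \<open>u\<close> to be cancelled in
  \<open>truncation_inequality\<close>.\<close>

lemma energy_finite: "E_energy n s p W u \<Omega> < \<infinity>"
proof -
  have "(\<integral>\<^sup>+x\<in>\<Omega>. ennreal (W (u x)) \<partial>PiLeb n) \<le> (\<integral>\<^sup>+x. ennreal (Lam * 2 powr m) * indicator \<Omega> x \<partial>PiLeb n)"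
  proof (rule nn_integral_mono)
    fix x
    have "W (u x) \<le> Lam * \<bar>1 + u x\<bar> powr m"
      using u_bdd[of x] by (intro W_le) auto
    also have "\<dots> \<le> Lam * 2 powr m"
      using u_bdd[of x] Lam m by (intro mult_left_mono powr_mono2) auto
    finally show "ennreal (W (u x)) * indicator \<Omega> x \<le> ennreal (Lam * 2 powr m) * indicator \<Omega> x"
      by (intro mult_right_mono ennreal_leI) auto
  qed
  also have "\<dots> = ennreal (Lam * 2 powr m) * emeasure (PiLeb n) \<Omega>"
    by (rule nn_integral_cmult_indicator) simp
  also have "\<dots> < \<infinity>"
    using \<Omega>_fin by (simp add: ennreal_mult_less_top)
  finally show ?thesis
    using K_fin by (simp add: E_energy_def nn_integral_Leb)
qed

section \<open>Comparison with the truncation\<close>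

text \<open>Every point outside the ball has distance at least \<open>R - L2_set y {..<n}\<close>
  from \<open>y\<close>, so \<open>kernel_tail_le\<close> with this radius bounds the inner
  integral.\<close>

lemma outside_interaction_le:
  assumes h: "0 < h"
  shows "(\<integral>\<^sup>+y. indicator (ball_Rn n R) y * ennreal (excess h y) *
        (\<integral>\<^sup>+x. indicator (Rn n - ball_Rn n R) x * ennreal (1 / dist_Rn n x y powr (real n + s * p)) \<partial>PiLeb n) \<partial>PiLeb n)
    \<le> ennreal (4 ^ n / (1 - 2 powr - (s * p))) *
      (\<integral>\<^sup>+y. indicator (ball_Rn n R) y * ennreal ((R - L2_set y {..<n}) powr - (s * p)) * ennreal (excess h y) \<partial>PiLeb n)"
proof -
  let ?k = "\<lambda>x y. ennreal (1 / dist_Rn n x y powr (real n + s * p))"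
  let ?Ct = "4 ^ n / (1 - 2 powr - (s * p))"
  have Ct: "0 \<le> ?Ct" using s by (simp add: powr_less_one less_imp_le)
  have "(\<integral>\<^sup>+y. indicator (ball_Rn n R) y * ennreal (excess h y) *
        (\<integral>\<^sup>+x. indicator (Rn n - ball_Rn n R) x * ?k x y \<partial>PiLeb n) \<partial>PiLeb n)
     \<le> (\<integral>\<^sup>+y. ennreal ?Ct * (indicator (ball_Rn n R) y * ennreal ((R - L2_set y {..<n}) powr - (s * p)) * ennreal (excess h y)) \<partial>PiLeb n)"
  proof (rule nn_integral_mono)
    fix y
    show "indicator (ball_Rn n R) y * ennreal (excess h y) * (\<integral>\<^sup>+x. indicator (Rn n - ball_Rn n R) x * ?k x y \<partial>PiLeb n)
      \<le> ennreal ?Ct * (indicator (ball_Rn n R) y * ennreal ((R - L2_set y {..<n}) powr - (s * p)) * ennreal (excess h y))"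
    proof (cases "y \<in> ball_Rn n R")
      case True
      then have y: "y \<in> Rn n" "L2_set y {..<n} < R" by (auto simp: ball_Rn_def)
      have "(\<integral>\<^sup>+x. indicator (Rn n - ball_Rn n R) x * ?k x y \<partial>PiLeb n)
         \<le> (\<integral>\<^sup>+x. indicator {x. R - L2_set y {..<n} \<le> dist_Rn n y x} x * ?k y x \<partial>PiLeb n)"
      proof (rule nn_integral_mono)
        fix x
        have "R - L2_set y {..<n} \<le> dist_Rn n y x" if "x \<in> Rn n - ball_Rn n R"
          using that L2_set_le_dist_Rn[of x n y] by (auto simp: ball_Rn_def)
        then show "indicator (Rn n - ball_Rn n R) x * ?k x y \<le> indicator {x. R - L2_set y {..<n} \<le> dist_Rn n y x} x * ?k y x"
          by (auto simp: dist_Rn_sym[of n x y] split: split_indicator)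
      qed
      also have "\<dots> \<le> ennreal (?Ct * (R - L2_set y {..<n}) powr - (s * p))"
        using y s by (intro kernel_tail_le) auto
      also have "\<dots> = ennreal ?Ct * ennreal ((R - L2_set y {..<n}) powr - (s * p))"
        using Ct by (intro ennreal_mult) auto
      finally have "ennreal (excess h y) * (\<integral>\<^sup>+x. indicator (Rn n - ball_Rn n R) x * ?k x y \<partial>PiLeb n)
        \<le> ennreal (excess h y) * (ennreal ?Ct * ennreal ((R - L2_set y {..<n}) powr - (s * p)))"
        by (intro mult_left_mono) auto
      with True show ?thesis by (simp add: mult_ac)
    qed simp
  qed
  also have "\<dots> = ennreal ?Ct * (\<integral>\<^sup>+y. indicator (ball_Rn n R) y * ennreal ((R - L2_set y {..<n}) powr - (s * p)) * ennreal (excess h y) \<partial>PiLeb n)"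
    by (rule nn_integral_cmult) measurable
  finally show ?thesis .
qed


text \<open>Up to \<open>-1 + h\<close> nothing changes. From there to \<open>\<tau>\<close> the
  mean value bound gives the gain. Above \<open>\<tau>\<close>, where \<open>W\<close> may fail to
  be monotone, the new value is at most \<open>Lam * h powr m\<close> and the old one counts as
  nonnegative.\<close>

lemma potential_le:
  assumes h: "0 < h" "h \<le> (1 + \<tau>) / 4" and R: "ball_Rn n R \<subseteq> \<Omega>"
  shows "(\<integral>\<^sup>+x\<in>\<Omega>. ennreal (W (truncate n R (-1 + h) u x)) \<partial>PiLeb n) + ennreal (c1 * h powr (m - 1)) * low_excess h R
    \<le> (\<integral>\<^sup>+x\<in>\<Omega>. ennreal (W (u x)) \<partial>PiLeb n) + ennreal (Lam * h powr m) * high_volume R"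
proof -
  let ?v = "truncate n R (-1 + h) u"
  let ?A = "{x \<in> ball_Rn n R. u x \<le> \<tau>}" and ?B = "{x \<in> ball_Rn n R. \<tau> < u x}"
  have vm [measurable]: "?v \<in> borel_measurable (PiLeb n)"
    unfolding truncate_def by measurable
  have v: "\<bar>?v x\<bar> \<le> 1" for x
    using u_bdd[of x] h tau by (auto simp: truncate_def)
  have [measurable]: "(\<lambda>x. W (?v x)) \<in> borel_measurable (PiLeb n)" "(\<lambda>x. W (u x)) \<in> borel_measurable (PiLeb n)"
    by (rule W_measurable[OF vm v], rule W_measurable[OF u_meas u_bdd])
  have pw: "ennreal (W (?v x)) * indicator \<Omega> x + ennreal (c1 * h powr (m - 1)) * (indicator ?A x * ennreal (excess h x))
     \<le> ennreal (W (u x)) * indicator \<Omega> x + ennreal (Lam * h powr m) * indicator ?B x" for x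
  proof (cases "x \<in> ball_Rn n R")
    case False
    then show ?thesis by (simp add: truncate_def)
  next
    case True
    then have x\<Omega>: "x \<in> \<Omega>" using R by auto
    consider "u x \<le> -1 + h" | "-1 + h < u x" "u x \<le> \<tau>" | "\<tau> < u x" by linarith
    then show ?thesis
    proof cases
      case 1
      then show ?thesis using h tau x\<Omega> True by (simp add: truncate_def excess_def min_def)
    next
      case 2
      then have "W (-1 + h) + c1 * h powr (m - 1) * (u x - (-1 + h)) \<le> W (u x)"
        using m c1 h tau W_deriv W'_ge by (intro potential_truncation[where W' = W' and \<tau> = \<tau>]) auto
      then have "ennreal (W (-1 + h) + c1 * h powr (m - 1) * excess h x) \<le> ennreal (W (u x))"
        using 2 by (intro ennreal_leI) (simp add: excess_def)
      moreover have "0 \<le> W (-1 + h)" using h tau by (intro W_nonneg) auto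
      ultimately have "ennreal (W (-1 + h)) + ennreal (c1 * h powr (m - 1)) * ennreal (excess h x) \<le> ennreal (W (u x))"
        using c1 by (simp add: ennreal_mult)
      then show ?thesis using 2 x\<Omega> True by (simp add: truncate_def)
    next
      case 3
      then have "?v x = -1 + h" using True h tau by (simp add: truncate_def)
      moreover have "W (-1 + h) \<le> Lam * h powr m"
        using W_le[of "-1 + h"] h tau by simp
      ultimately have "ennreal (W (?v x)) \<le> ennreal (Lam * h powr m)"
        by (intro ennreal_leI) simp
      then show ?thesis using 3 x\<Omega> True by (simp add: add_increasing)
    qed
  qed
  have "(\<integral>\<^sup>+x\<in>\<Omega>. ennreal (W (?v x)) \<partial>PiLeb n) + ennreal (c1 * h powr (m - 1)) * low_excess h R
     = (\<integral>\<^sup>+x. ennreal (W (?v x)) * indicator \<Omega> x + ennreal (c1 * h powr (m - 1)) * (indicator ?A x * ennreal (excess h x)) \<partial>PiLeb n)"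
    unfolding low_excess_def
    by (subst nn_integral_add, measurable, subst nn_integral_cmult, measurable)
  also have "\<dots> \<le> (\<integral>\<^sup>+x. ennreal (W (u x)) * indicator \<Omega> x + ennreal (Lam * h powr m) * indicator ?B x \<partial>PiLeb n)"
    by (intro nn_integral_mono pw)
  also have "\<dots> = (\<integral>\<^sup>+x\<in>\<Omega>. ennreal (W (u x)) \<partial>PiLeb n) + ennreal (Lam * h powr m) * high_volume R"
    unfolding high_volume_def by (subst nn_integral_add) (auto simp: nn_integral_cmult_indicator)
  finally show ?thesis .
qed

text \<open>\<open>K_energy_truncation_le\<close> with the levels \<Theta> and \<Theta>/2;
  \<open>h \<le> (1 + \<tau>) / 4\<close> puts the truncation below both. The gain is taken in the
  smaller ball because \<open>R\<close> will be known only up to an interval.\<close>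

lemma truncation_energy_le:
  assumes h: "0 < h" "h \<le> (1 + \<tau>) / 4" and R: "ball_Rn n R \<subseteq> \<Omega>" "r \<le> R"
  shows "K_energy n s p (truncate n R (-1 + h) u) \<Omega> + ennreal (((1 + \<tau>) / 2) powr p / 2) * interaction r
    \<le> K_energy n s p u \<Omega> + ennreal (p * 2 powr p) *
      (\<integral>\<^sup>+y. indicator (ball_Rn n R) y * ennreal (excess h y) *
        (\<integral>\<^sup>+x. indicator (Rn n - ball_Rn n R) x * ennreal (1 / dist_Rn n x y powr (real n + s * p)) \<partial>PiLeb n) \<partial>PiLeb n)"
proof -
  have sub: "{y \<in> ball_Rn n r. \<tau> < u y} \<subseteq> ball_Rn n R" "{x \<in> ball_Rn n r. u x \<le> -1 + (1 + \<tau>) / 2} \<subseteq> ball_Rn n R"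
    using ball_Rn_mono[OF R(2), of n] by auto
  have e: "\<tau> - (-1 + (1 + \<tau>) / 2) = (1 + \<tau>) / 2" by (simp add: field_simps)
  show ?thesis
    using K_energy_truncation_le[OF \<Omega> ball_Rn_sets u_meas level_sets_measurable(1) level_sets_measurable(2) R(1) sub,
        of p "-1 + h" \<tau> "-1 + (1 + \<tau>) / 2" s] p u_bdd h tau
    unfolding e interaction_def excess_def truncate_def by (auto simp: field_simps)
qed

text \<open>Minimality against the truncation on the ball of a radius \<open>R\<close> from
  \<open>good_radius\<close>: gains do not exceed losses. Monotonicity in the radius then removes
  \<open>R\<close>.\<close>

lemma truncation_inequality:
  assumes h: "0 < h" "h \<le> (1 + \<tau>) / 4" and w: "0 < w" and sub: "ball_Rn n (r + w) \<subseteq> \<Omega>"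
  shows "ennreal (((1 + \<tau>) / 2) powr p / 2) * interaction r + ennreal (c1 * h powr (m - 1)) * low_excess h r
    \<le> ennreal (tail_const n s p * w powr - (s * p)) * (low_excess h (r + w) + 2 * high_volume (r + w))
      + ennreal (Lam * h powr m) * high_volume (r + w)"
proof -
  define X where "X = (\<integral>\<^sup>+x. indicator (ball_Rn n (r + w)) x * ennreal (excess h x) \<partial>PiLeb n)"
  obtain R where R: "r \<le> R" "R \<le> r + w" and good:
    "(\<integral>\<^sup>+x. indicator (ball_Rn n R) x * ennreal ((R - L2_set x {..<n}) powr - (s * p)) * ennreal (excess h x) \<partial>PiLeb n)
      \<le> ennreal (2 / (1 - s * p) * w powr - (s * p)) * X"
    using good_radius[of "\<lambda>x. ennreal (excess h x)" n w "s * p" r] w s total_excess_finite[OF h(1)]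
    unfolding X_def by auto
  have RO: "ball_Rn n R \<subseteq> \<Omega>" using ball_Rn_mono[OF R(2), of n] sub by auto
  let ?v = "truncate n R (-1 + h) u"
  define L where "L = ennreal (tail_const n s p * w powr - (s * p)) * X"
  define G where "G = ennreal (((1 + \<tau>) / 2) powr p / 2) * interaction r"
  define PG where "PG = ennreal (c1 * h powr (m - 1)) * low_excess h R"
  define PL where "PL = ennreal (Lam * h powr m) * high_volume R"
  have K: "K_energy n s p ?v \<Omega> + G \<le> K_energy n s p u \<Omega> + L"
  proof -
    let ?Ct = "4 ^ n / (1 - 2 powr - (s * p))"
    have Ct: "0 \<le> ?Ct" using s by (simp add: powr_less_one less_imp_le)
    have "ennreal (p * 2 powr p) *
      (\<integral>\<^sup>+y. indicator (ball_Rn n R) y * ennreal (excess h y) *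
        (\<integral>\<^sup>+x. indicator (Rn n - ball_Rn n R) x * ennreal (1 / dist_Rn n x y powr (real n + s * p)) \<partial>PiLeb n) \<partial>PiLeb n)
      \<le> ennreal (p * 2 powr p) * (ennreal ?Ct * (ennreal (2 / (1 - s * p) * w powr - (s * p)) * X))"
      by (intro mult_left_mono order_trans[OF outside_interaction_le[OF h(1)]] good) auto
    also have "\<dots> = (ennreal (p * 2 powr p) * ennreal ?Ct * ennreal (2 / (1 - s * p) * w powr - (s * p))) * X"
      by (simp only: mult.assoc)
    also have "ennreal (p * 2 powr p) * ennreal ?Ct * ennreal (2 / (1 - s * p) * w powr - (s * p)) = ennreal (tail_const n s p * w powr - (s * p))"
    proof -
      have "tail_const n s p * w powr - (s * p) = (p * 2 powr p * ?Ct) * (2 / (1 - s * p) * w powr - (s * p))"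
        by (simp only: tail_const_def mult.assoc)
      moreover have "ennreal (p * 2 powr p) * ennreal ?Ct = ennreal (p * 2 powr p * ?Ct)"
        using p Ct by (intro ennreal_mult[symmetric]) auto
      moreover have "ennreal (p * 2 powr p * ?Ct) * ennreal (2 / (1 - s * p) * w powr - (s * p))
          = ennreal (p * 2 powr p * ?Ct * (2 / (1 - s * p) * w powr - (s * p)))"
        using p s Ct by (intro ennreal_mult[symmetric] mult_nonneg_nonneg) auto
      ultimately show ?thesis by (simp only:)
    qed
    finally show ?thesis
      using truncation_energy_le[OF h RO R(1)] unfolding L_def G_def
      by (meson add_left_mono order_trans)
  qed
  have Xle: "X \<le> low_excess h (r + w) + 2 * high_volume (r + w)"
    unfolding X_def by (rule total_excess_le[OF h(1)])
  have Xfin: "X < \<infinity>" unfolding X_def by (rule total_excess_finite[OF h(1)])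
  then have Lfin: "L < \<infinity>" by (simp add: L_def ennreal_mult_less_top)
  \<comment> \<open>Minimality applies only to competitors of finite energy; here the comparison
    \<open>K\<close> itself supplies the finiteness.\<close>
  have Kv: "K_energy n s p ?v \<Omega> < \<infinity>"
  proof -
    have "K_energy n s p u \<Omega> + L < \<infinity>" using K_fin Lfin by simp
    moreover have "K_energy n s p ?v \<Omega> \<le> K_energy n s p u \<Omega> + L"
      by (rule order_trans[OF _ K]) simp
    ultimately show ?thesis by (simp only: le_less_trans)
  qed
  have "E_energy n s p W u \<Omega> \<le> E_energy n s p W ?v \<Omega>"
    using h tau by (intro minimal RO Kv) auto
  \<comment> \<open>The gains are added to both sides so that no energy has to be
    subtracted.\<close>
  then have "E_energy n s p W u \<Omega> + (G + PG) \<le> E_energy n s p W ?v \<Omega> + (G + PG)"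
    by (rule add_right_mono)
  also have "\<dots> = (K_energy n s p ?v \<Omega> + G) + ((\<integral>\<^sup>+x\<in>\<Omega>. ennreal (W (?v x)) \<partial>PiLeb n) + PG)"
    by (simp add: E_energy_def nn_integral_Leb ac_simps)
  also have "\<dots> \<le> (K_energy n s p u \<Omega> + L) + ((\<integral>\<^sup>+x\<in>\<Omega>. ennreal (W (u x)) \<partial>PiLeb n) + PL)"
    unfolding PG_def PL_def by (intro add_mono K potential_le h RO)
  also have "\<dots> = E_energy n s p W u \<Omega> + (L + PL)"
    by (simp add: E_energy_def nn_integral_Leb ac_simps)
  finally have "G + PG \<le> L + PL"
    using energy_finite by (auto simp: ennreal_add_left_cancel_le)
  moreover have "ennreal (c1 * h powr (m - 1)) * low_excess h r \<le> PG"
    unfolding PG_def by (intro mult_left_mono low_excess_mono R) auto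
  moreover have "PL \<le> ennreal (Lam * h powr m) * high_volume (r + w)"
    unfolding PL_def by (intro mult_left_mono high_volume_mono R) auto
  moreover have "L \<le> ennreal (tail_const n s p * w powr - (s * p)) * (low_excess h (r + w) + 2 * high_volume (r + w))"
    unfolding L_def by (intro mult_left_mono Xle) auto
  ultimately show ?thesis
    unfolding G_def by (meson add_mono order_refl order_trans)
qed


section \<open>Decay of the excess\<close>

definition lexc :: "real \<Rightarrow> real \<Rightarrow> real" where "lexc h r = enn2real (low_excess h r)"
definition hvol :: "real \<Rightarrow> real" where "hvol r = enn2real (high_volume r)"

lemma low_excess_finite:
  assumes "0 < h"
  shows "low_excess h r < \<infinity>"
proof -
  have "low_excess h r \<le> (\<integral>\<^sup>+x. indicator (ball_Rn n r) x * ennreal (excess h x) \<partial>PiLeb n)"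
    unfolding low_excess_def by (intro nn_integral_mono mult_right_mono) (auto split: split_indicator)
  then show ?thesis using total_excess_finite[OF assms, of r] by (rule le_less_trans)
qed

lemma low_excess_eq: "0 < h \<Longrightarrow> low_excess h r = ennreal (lexc h r)"
  unfolding lexc_def using low_excess_finite[of h r] by (simp add: ennreal_enn2real_if)

lemma high_volume_eq: "high_volume r = ennreal (hvol r)"
  unfolding hvol_def using high_volume_finite[of r] by (simp add: ennreal_enn2real_if)

lemma lexc_nonneg [simp]: "0 \<le> lexc h r" and hvol_nonneg [simp]: "0 \<le> hvol r"
  by (simp_all add: lexc_def hvol_def)

lemma hvol_mono: "r \<le> r' \<Longrightarrow> hvol r \<le> hvol r'"
  using high_volume_mono[of r r'] by (simp add: high_volume_eq)

lemma lexc_mono: "0 < h \<Longrightarrow> r \<le> r' \<Longrightarrow> lexc h r \<le> lexc h r'"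
  using low_excess_mono[of r r' h] by (simp add: low_excess_eq)

lemma tail_pos: "0 < tail_const n s p"
  using p s by (intro tail_const_pos) auto

text \<open>\<open>hw\<close> makes the coefficient of the potential gain twice that of the loss.
  The cost above \<open>\<tau>\<close> has the same order, as
  \<open>h powr m \<le> h powr (m - 1)\<close>. \<open>J\<close> is any real lower bound of the
  interaction.\<close>

lemma truncation_inequality_real:
  assumes h: "0 < h" "h \<le> (1 + \<tau>) / 4" and w: "0 < w" and sub: "ball_Rn n (r + w) \<subseteq> \<Omega>"
    and hw: "c1 * h powr (m - 1) = 2 * (tail_const n s p * w powr - (s * p))"
    and J: "0 \<le> J" "ennreal J \<le> interaction r"
  shows "((1 + \<tau>) / 2) powr p / 2 * J + 2 * (tail_const n s p * w powr - (s * p)) * lexc h r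
    \<le> tail_const n s p * w powr - (s * p) * (lexc h (r + w) + 2 * (1 + Lam / c1) * hvol (r + w))"
proof -
  define C where "C = tail_const n s p * w powr - (s * p)"
  have C: "0 < C" using tail_pos w by (simp add: C_def)
  define g where "g = ((1 + \<tau>) / 2) powr p / 2"
  have g: "0 \<le> g" by (simp add: g_def)
  have "ennreal g * ennreal J + ennreal (2 * C) * ennreal (lexc h r)
    \<le> ennreal g * interaction r + ennreal (c1 * h powr (m - 1)) * low_excess h r"
    unfolding hw C_def[symmetric] low_excess_eq[OF h(1)] by (intro add_mono mult_left_mono J) auto
  also have "\<dots> \<le> ennreal C * (low_excess h (r + w) + 2 * high_volume (r + w))
      + ennreal (Lam * h powr m) * high_volume (r + w)"
    unfolding g_def C_def by (rule truncation_inequality[OF h w sub])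
  also have "\<dots> = ennreal (C * (lexc h (r + w) + 2 * hvol (r + w)) + Lam * h powr m * hvol (r + w))"
  proof -
    have "2 * ennreal (hvol (r + w)) = ennreal (2 * hvol (r + w))"
      by (simp add: ennreal_mult)
    then show ?thesis
      using C Lam unfolding low_excess_eq[OF h(1)] high_volume_eq
      by (simp add: ennreal_mult[symmetric] ennreal_plus[symmetric] del: ennreal_plus)
  qed
  finally have "ennreal (g * J + 2 * C * lexc h r)
     \<le> ennreal (C * (lexc h (r + w) + 2 * hvol (r + w)) + Lam * h powr m * hvol (r + w))"
    using g J(1) C by (simp add: ennreal_mult[symmetric] ennreal_plus[symmetric] del: ennreal_plus)
  then have "g * J + 2 * C * lexc h r \<le> C * (lexc h (r + w) + 2 * hvol (r + w)) + Lam * h powr m * hvol (r + w)"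
    using C Lam by (subst (asm) ennreal_le_iff) auto
  moreover have "Lam * h powr m * hvol (r + w) \<le> Lam * (2 * C / c1) * hvol (r + w)"
  proof -
    have "h powr m \<le> h powr (m - 1)"
      using h tau by (intro powr_mono') auto
    also have "\<dots> = 2 * C / c1"
      using hw c1 by (simp add: C_def field_simps)
    finally show ?thesis using Lam by (intro mult_right_mono mult_left_mono) auto
  qed
  moreover have "C * (lexc h (r + w) + 2 * hvol (r + w)) + Lam * (2 * C / c1) * hvol (r + w)
     = C * (lexc h (r + w) + 2 * (1 + Lam / c1) * hvol (r + w))"
    using c1 by (simp add: field_simps)
  ultimately show ?thesis unfolding C_def g_def by linarith
qed

text \<open>The case \<open>J = 0\<close>, divided by the common factor.\<close>

lemma lexc_halving:
  assumes "0 < h" "h \<le> (1 + \<tau>) / 4" "0 < w" "ball_Rn n (r + w) \<subseteq> \<Omega>"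
    "c1 * h powr (m - 1) = 2 * (tail_const n s p * w powr - (s * p))"
  shows "lexc h r \<le> lexc h (r + w) / 2 + (1 + Lam / c1) * hvol (r + w)"
proof -
  have C: "0 < tail_const n s p * w powr - (s * p)" using tail_pos assms by simp
  have "2 * (tail_const n s p * w powr - (s * p)) * lexc h r
    \<le> tail_const n s p * w powr - (s * p) * (lexc h (r + w) + 2 * (1 + Lam / c1) * hvol (r + w))"
    using truncation_inequality_real[OF assms order_refl] by simp
  then have "(tail_const n s p * w powr - (s * p)) * (2 * lexc h r)
    \<le> (tail_const n s p * w powr - (s * p)) * (lexc h (r + w) + 2 * (1 + Lam / c1) * hvol (r + w))"
    by (simp only: mult_ac)
  then have "2 * lexc h r \<le> lexc h (r + w) + 2 * (1 + Lam / c1) * hvol (r + w)"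
    using C by (simp only: mult_le_cancel_left_pos)
  then have "2 * lexc h r \<le> lexc h (r + w) + 2 * ((1 + Lam / c1) * hvol (r + w))"
    by (simp only: mult.assoc)
  then show ?thesis by linarith
qed

text \<open>The volume terms carry the factors 1, 1/2, 1/4 and so on, with sum at most 2, and all
  volumes are estimated at the largest radius.\<close>

lemma lexc_iterated:
  assumes h: "0 < h" "h \<le> (1 + \<tau>) / 4" and w: "0 < w"
    and hw: "c1 * h powr (m - 1) = 2 * (tail_const n s p * w powr - (s * p))"
    and sub: "ball_Rn n (r + real k * w) \<subseteq> \<Omega>"
  shows "lexc h r \<le> lexc h (r + real k * w) / 2 ^ k + 2 * (1 + Lam / c1) * hvol (r + real k * w)"
  using sub
proof (induction k arbitrary: r)
  case 0
  then show ?case using Lam c1 by simp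
next
  case (Suc k)
  have e: "r + w + real k * w = r + real (Suc k) * w" by (simp add: algebra_simps)
  have le: "r + w \<le> r + real (Suc k) * w" using w by (simp add: algebra_simps)
  let ?B = "(1 + Lam / c1) * hvol (r + real (Suc k) * w)"
  have "lexc h r \<le> lexc h (r + w) / 2 + (1 + Lam / c1) * hvol (r + w)"
    using ball_Rn_mono[OF le, of n] Suc.prems by (intro lexc_halving h w hw) auto
  also have "(1 + Lam / c1) * hvol (r + w) \<le> ?B"
    using Lam c1 by (intro mult_left_mono hvol_mono le) auto
  also have "lexc h (r + w) \<le> lexc h (r + real (Suc k) * w) / 2 ^ k + 2 * ?B"
    using Suc.IH[of "r + w"] Suc.prems unfolding e by (simp only: mult.assoc)
  finally show ?case by (simp add: field_simps)
qed

text \<open>The crude bound fed into the iteration: where \<open>u x \<le> \<tau> < 0\<close>, the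
  excess is at most 1.\<close>

lemma lexc_le_volume:
  assumes "0 < h" "0 \<le> r"
  shows "lexc h r \<le> (2 * r) ^ n"
proof -
  have "low_excess h r \<le> (\<integral>\<^sup>+x. indicator (ball_Rn n r) x \<partial>PiLeb n)"
    unfolding low_excess_def
  proof (rule nn_integral_mono)
    fix x
    have "ennreal (excess h x) \<le> 1" if "u x \<le> \<tau>"
      using that assms tau by (intro ennreal_le_1[THEN iffD2]) (auto simp: excess_def)
    then show "indicator {x \<in> ball_Rn n r. u x \<le> \<tau>} x * ennreal (excess h x) \<le> indicator (ball_Rn n r) x"
      by (auto split: split_indicator)
  qed
  also have "\<dots> \<le> ennreal ((2 * r) ^ n)"
    using emeasure_ball_Rn_le[OF assms(2)] by simp
  finally show ?thesis
    unfolding low_excess_eq[OF assms(1)] using assms by (subst (asm) ennreal_le_iff) auto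
qed

section \<open>Lower bound for the interaction\<close>

text \<open>Chebyshev's inequality: where U lies between \<Theta>/2 and \<Theta>, the excess is at
  least \<Theta>/2 - h, hence at least \<Theta>/4.\<close>

lemma middle_volume_le:
  assumes h: "0 < h" "h \<le> (1 + \<tau>) / 4"
  shows "emeasure (PiLeb n) {x \<in> ball_Rn n r. -1 + (1 + \<tau>) / 2 < u x} \<le> ennreal (hvol r + 4 / (1 + \<tau>) * lexc h r)"
proof -
  let ?A = "{x \<in> ball_Rn n r. u x \<le> \<tau>}" and ?B = "{x \<in> ball_Rn n r. \<tau> < u x}"
  let ?M = "{x \<in> ball_Rn n r. -1 + (1 + \<tau>) / 2 < u x}"
  have "?M = {x \<in> space (PiLeb n). x \<in> ball_Rn n r \<and> -1 + (1 + \<tau>) / 2 < u x}"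
    by (auto simp: ball_Rn_def space_PiLeb)
  then have [measurable]: "?M \<in> sets (PiLeb n)" by simp
  have "emeasure (PiLeb n) ?M = (\<integral>\<^sup>+x. indicator ?M x \<partial>PiLeb n)" by simp
  also have "\<dots> \<le> (\<integral>\<^sup>+x. indicator ?B x + ennreal (4 / (1 + \<tau>)) * (indicator ?A x * ennreal (excess h x)) \<partial>PiLeb n)"
  proof (rule nn_integral_mono)
    fix x
    have *: "1 \<le> ennreal (4 / (1 + \<tau>)) * ennreal (excess h x)" if "-1 + (1 + \<tau>) / 2 < u x" "u x \<le> \<tau>"
    proof -
      have "(1 + \<tau>) / 4 \<le> excess h x" using that h by (auto simp: excess_def field_simps)
      then have "1 \<le> 4 / (1 + \<tau>) * excess h x" using tau by (simp add: field_simps)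
      then show ?thesis using tau by (simp add: ennreal_mult'[symmetric])
    qed
    show "indicator ?M x \<le> indicator ?B x + ennreal (4 / (1 + \<tau>)) * (indicator ?A x * ennreal (excess h x))"
    proof (cases "x \<in> ?M")
      case True
      then consider "x \<in> ?B" | "x \<in> ?A" "\<not> \<tau> < u x" by force
      then show ?thesis
      proof cases
        case 1
        then show ?thesis using True by (simp add: add_increasing2)
      next
        case 2
        then show ?thesis using True * by (simp add: add_increasing)
      qed
    qed simp
  qed
  also have "\<dots> = high_volume r + ennreal (4 / (1 + \<tau>)) * low_excess h r"
    unfolding high_volume_def low_excess_def nn_integral_indicator[OF level_sets_measurable(1), symmetric]
    by (subst nn_integral_add, measurable, subst nn_integral_cmult, measurable)
  also have "\<dots> = ennreal (hvol r + 4 / (1 + \<tau>) * lexc h r)"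
    unfolding high_volume_eq low_excess_eq[OF h(1)] using tau by (simp add: ennreal_mult'[symmetric])
  finally show ?thesis .
qed

text \<open>\<open>kernel_outside_ge\<close> with E the set where U exceeds \<Theta>/2, integrated
  over the points of the superlevel set in the ball of radius \<open>\<rho>\<close>.\<close>

lemma interaction_ge:
  assumes t: "0 < t" "real n * t \<le> \<rho>"
    and vol: "emeasure (PiLeb n) {x \<in> ball_Rn n (2 * \<rho>). -1 + (1 + \<tau>) / 2 < u x} \<le> ennreal ((2 * t) ^ n / 2)"
  shows "ennreal (hvol \<rho> * ((2 * t) ^ n / 2 * (real n * t) powr - (real n + s * p))) \<le> interaction (2 * \<rho>)"
proof -
  let ?E = "{x \<in> space (PiLeb n). -1 + (1 + \<tau>) / 2 < u x}"
  let ?c = "(2 * t) ^ n / 2 * (real n * t) powr - (real n + s * p)"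
  let ?P = "{y \<in> ball_Rn n \<rho>. \<tau> < u y}"
  have \<rho>: "0 \<le> \<rho>" using t by (meson mult_nonneg_nonneg of_nat_0_le_iff less_imp_le order_trans)
  have inner: "ennreal ?c \<le> (\<integral>\<^sup>+x. indicator {x \<in> ball_Rn n (2 * \<rho>). u x \<le> -1 + (1 + \<tau>) / 2} x *
        ennreal (1 / dist_Rn n x y powr (real n + s * p)) \<partial>PiLeb n)" if y: "y \<in> ball_Rn n \<rho>" for y
  proof -
    have "?E \<inter> ball_Rn n (2 * \<rho>) = {x \<in> ball_Rn n (2 * \<rho>). -1 + (1 + \<tau>) / 2 < u x}"
      by (auto simp: ball_Rn_def space_PiLeb)
    then have "ennreal ?c \<le> (\<integral>\<^sup>+x. indicator (ball_Rn n (2 * \<rho>) - ?E) x * ennreal (1 / dist_Rn n y x powr (real n + s * p)) \<partial>PiLeb n)"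
      using vol by (intro kernel_outside_ge[OF n s(1) y t]) auto
    also have "\<dots> = (\<integral>\<^sup>+x. indicator {x \<in> ball_Rn n (2 * \<rho>). u x \<le> -1 + (1 + \<tau>) / 2} x *
        ennreal (1 / dist_Rn n x y powr (real n + s * p)) \<partial>PiLeb n)"
      by (intro nn_integral_cong) (auto simp: dist_Rn_sym[of n y] not_less split: split_indicator)
    finally show ?thesis .
  qed
  have "ennreal (hvol \<rho> * ?c) = ennreal ?c * emeasure (PiLeb n) ?P"
    using t unfolding high_volume_def[symmetric] high_volume_eq by (simp add: ennreal_mult'[symmetric] mult.commute)
  also have "\<dots> = (\<integral>\<^sup>+y. ennreal ?c * indicator ?P y \<partial>PiLeb n)"
    by (rule nn_integral_cmult_indicator[symmetric]) simp
  also have "\<dots> \<le> interaction (2 * \<rho>)"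
    unfolding interaction_def
  proof (rule nn_integral_mono)
    fix y
    show "ennreal ?c * indicator ?P y \<le> indicator {y \<in> ball_Rn n (2 * \<rho>). \<tau> < u y} y *
        (\<integral>\<^sup>+x. indicator {x \<in> ball_Rn n (2 * \<rho>). u x \<le> -1 + (1 + \<tau>) / 2} x *
          ennreal (1 / dist_Rn n x y powr (real n + s * p)) \<partial>PiLeb n)"
    proof (cases "y \<in> ?P")
      case True
      then have "y \<in> ball_Rn n \<rho>" "y \<in> {y \<in> ball_Rn n (2 * \<rho>). \<tau> < u y}"
        using ball_Rn_mono[of \<rho> "2 * \<rho>" n] \<rho> by auto
      with True inner[of y] show ?thesis by simp
    qed simp
  qed
  finally show ?thesis .
qed


section \<open>Propagation of the density\<close>

text \<open>The radii: the interaction lives in the ball of radius \<open>2 * \<rho>\<close>, the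
  truncation reaches at most \<open>3 * \<rho>\<close>, and the \<open>K\<close> iteration steps
  lead from there to \<open>4 * \<rho>\<close>. \<open>big\<close> is the contradiction after
  division by \<open>\<rho> powr - (s * p) * (\<delta> * \<rho> ^ n)\<close>.\<close>

lemma hvol_doubling:
  fixes K :: nat and \<rho> t h :: real
  defines "\<delta> \<equiv> (1 / 2) ^ K" and "B \<equiv> 1 + Lam / c1"
  defines "C5 \<equiv> 8 ^ n + 2 * B * 4 ^ n"
  assumes K: "1 \<le> K" and \<rho>: "0 < \<rho>" and sub: "ball_Rn n (4 * \<rho>) \<subseteq> \<Omega>"
    and h: "0 < h" "h \<le> (1 + \<tau>) / 4"
    and hw: "c1 * h powr (m - 1) = 2 * (tail_const n s p * (\<rho> / real K) powr - (s * p))"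
    and t: "0 < t" "real n * t \<le> 1" "(4 ^ n + 4 / (1 + \<tau>) * C5) * \<delta> = (2 * t) ^ n / 2"
    and big: "tail_const n s p * (C5 + 2 * B * 4 ^ n) * real K
      < ((1 + \<tau>) / 2) powr p / 2 * (2 ^ n / 2 * real n powr - (real n + s * p)) * t powr - (s * p)"
    and start: "\<delta> * \<rho> ^ n \<le> hvol \<rho>"
  shows "\<delta> * (4 * \<rho>) ^ n \<le> hvol (4 * \<rho>)"
proof (rule ccontr)
  assume "\<not> ?thesis"
  then have v4: "hvol (4 * \<rho>) \<le> 4 ^ n * (\<delta> * \<rho> ^ n)"
    by (simp add: power_mult_distrib mult_ac)
  define w where "w = \<rho> / real K"
  have w: "0 < w" "w \<le> \<rho>" using K \<rho> by (auto simp: w_def field_simps)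
  have hw': "c1 * h powr (m - 1) = 2 * (tail_const n s p * w powr - (s * p))"
    using hw by (simp add: w_def)
  have \<delta>: "0 < \<delta>" by (simp add: \<delta>_def)
  have B: "0 < B" using Lam c1 by (simp add: B_def add_pos_nonneg)
  have C5: "0 < C5" using B by (simp add: C5_def add_pos_pos)
  have X: "0 < \<delta> * \<rho> ^ n" using \<delta> \<rho> by simp
  let ?X = "\<delta> * \<rho> ^ n"
  have sub': "ball_Rn n r \<subseteq> \<Omega>" if "r \<le> 4 * \<rho>" for r
    using ball_Rn_mono[OF that, of n] sub by auto
  have l3: "lexc h (3 * \<rho>) \<le> C5 * ?X"
  proof -
    have e: "3 * \<rho> + real K * w = 4 * \<rho>" using K by (simp add: w_def)
    have "lexc h (3 * \<rho>) \<le> lexc h (4 * \<rho>) / 2 ^ K + 2 * B * hvol (4 * \<rho>)"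
      using lexc_iterated[OF h w(1) hw', of "3 * \<rho>" K] sub unfolding e B_def by auto
    \<comment> \<open>The damping factor of the iteration is \<open>\<delta>\<close> itself, so even
      the whole volume of the ball becomes a multiple of \<open>?X\<close>.\<close>
    also have "lexc h (4 * \<rho>) / 2 ^ K \<le> 8 ^ n * ?X"
      using lexc_le_volume[OF h(1), of "4 * \<rho>"] \<rho>
      by (simp add: \<delta>_def power_mult_distrib field_simps)
    also have "2 * B * hvol (4 * \<rho>) \<le> 2 * B * (4 ^ n * ?X)"
      using v4 B by (intro mult_left_mono) auto
    finally show ?thesis by (simp add: C5_def algebra_simps)
  qed
  \<comment> \<open>The test cube has half-side \<open>t * \<rho>\<close>; by \<open>t(3)\<close>
    the set where U exceeds \<Theta>/2 is small enough to fill at most half of it.\<close>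
  define J where "J = hvol \<rho> * ((2 * (t * \<rho>)) ^ n / 2 * (real n * (t * \<rho>)) powr - (real n + s * p))"
  have Jint: "ennreal J \<le> interaction (2 * \<rho>)"
    unfolding J_def
  proof (rule interaction_ge)
    show "0 < t * \<rho>" "real n * (t * \<rho>) \<le> \<rho>"
      using t \<rho> mult_right_mono[OF t(2), of \<rho>] by (auto simp: mult_ac)
    have "hvol (2 * \<rho>) \<le> 4 ^ n * ?X"
      using hvol_mono[of "2 * \<rho>" "4 * \<rho>"] v4 \<rho> by linarith
    moreover have "4 / (1 + \<tau>) * lexc h (2 * \<rho>) \<le> 4 / (1 + \<tau>) * (C5 * ?X)"
      using lexc_mono[OF h(1), of "2 * \<rho>" "3 * \<rho>"] l3 \<rho> tau by (intro mult_left_mono) auto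
    ultimately have "hvol (2 * \<rho>) + 4 / (1 + \<tau>) * lexc h (2 * \<rho>) \<le> (4 ^ n + 4 / (1 + \<tau>) * C5) * ?X"
      by (simp only: distrib_right mult.assoc)
    also have "\<dots> = ((4 ^ n + 4 / (1 + \<tau>) * C5) * \<delta>) * \<rho> ^ n"
      by (simp only: mult.assoc)
    also have "\<dots> = (2 * (t * \<rho>)) ^ n / 2"
      unfolding t(3) by (simp add: power_mult_distrib)
    finally have "ennreal (hvol (2 * \<rho>) + 4 / (1 + \<tau>) * lexc h (2 * \<rho>)) \<le> ennreal ((2 * (t * \<rho>)) ^ n / 2)"
      by (rule ennreal_leI)
    with middle_volume_le[OF h] show "emeasure (PiLeb n) {x \<in> ball_Rn n (2 * \<rho>). -1 + (1 + \<tau>) / 2 < u x} \<le> ennreal ((2 * (t * \<rho>)) ^ n / 2)"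
      by (rule order_trans)
  qed
  have J0: "0 \<le> J" using t \<rho> by (simp add: J_def)
  define g where "g = ((1 + \<tau>) / 2) powr p / 2"
  have g: "0 \<le> g" by (simp add: g_def)
  define T where "T = tail_const n s p * w powr - (s * p)"
  have T: "0 < T" using tail_pos w by (simp add: T_def)
  have "g * J + 2 * T * lexc h (2 * \<rho>) \<le> T * (lexc h (2 * \<rho> + w) + 2 * (1 + Lam / c1) * hvol (2 * \<rho> + w))"
    unfolding g_def T_def using w by (intro truncation_inequality_real h hw' sub' J0 Jint) auto
  moreover have "0 \<le> 2 * T * lexc h (2 * \<rho>)" using T by simp
  ultimately have "g * J \<le> T * (lexc h (2 * \<rho> + w) + 2 * B * hvol (2 * \<rho> + w))"
    unfolding B_def by linarith
  also have "\<dots> \<le> T * (C5 * ?X + 2 * B * (4 ^ n * ?X))"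
  proof (intro mult_left_mono add_mono)
    show "lexc h (2 * \<rho> + w) \<le> C5 * ?X"
      using lexc_mono[OF h(1), of "2 * \<rho> + w" "3 * \<rho>"] l3 w by linarith
    show "hvol (2 * \<rho> + w) \<le> 4 ^ n * ?X"
      using hvol_mono[of "2 * \<rho> + w" "4 * \<rho>"] v4 w \<rho> by linarith
  qed (use T B in auto)
  also have "\<dots> = T * (C5 + 2 * B * 4 ^ n) * ?X"
    by (simp add: algebra_simps)
  \<comment> \<open>The width \<open>w\<close> costs the factor \<open>real K powr (s * p)\<close>,
    at most \<open>real K\<close> since \<open>s * p < 1\<close>.\<close>
  also have "\<dots> \<le> (tail_const n s p * (real K * \<rho> powr - (s * p))) * (C5 + 2 * B * 4 ^ n) * ?X"
  proof -
    have "w powr - (s * p) = real K powr (s * p) * \<rho> powr - (s * p)"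
      using K \<rho> by (simp add: w_def powr_divide powr_minus_divide)
    also have "\<dots> \<le> real K * \<rho> powr - (s * p)"
      using K s powr_mono[of "s * p" 1 "real K"] by (intro mult_right_mono) auto
    finally have "T \<le> tail_const n s p * (real K * \<rho> powr - (s * p))"
      unfolding T_def using tail_pos by (intro mult_left_mono) auto
    then show ?thesis using X B C5 by (intro mult_right_mono) auto
  qed
  also have "\<dots> = (tail_const n s p * (C5 + 2 * B * 4 ^ n) * real K) * (\<rho> powr - (s * p) * ?X)"
    by (simp only: mult_ac)
  also have "\<dots> < (g * (2 ^ n / 2 * real n powr - (real n + s * p)) * t powr - (s * p)) * (\<rho> powr - (s * p) * ?X)"
    unfolding g_def using X \<rho> by (intro mult_strict_right_mono[OF big] mult_pos_pos[OF _ X]) auto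
  \<comment> \<open>The powers \<open>(t * \<rho>) ^ n\<close> from the cube and from the kernel
    cancel, leaving \<open>t powr - (s * p)\<close>.\<close>
  also have "\<dots> = g * (?X * ((2 * (t * \<rho>)) ^ n / 2 * (real n * (t * \<rho>)) powr - (real n + s * p)))"
  proof -
    have t\<rho>: "0 < t * \<rho>" using t \<rho> by simp
    have "(real n * (t * \<rho>)) powr - (real n + s * p) = real n powr - (real n + s * p) * (t * \<rho>) powr - (real n + s * p)"
      using t \<rho> by (simp add: powr_mult)
    also have "(t * \<rho>) powr - (real n + s * p) = (t * \<rho>) powr - (s * p) / (t * \<rho>) ^ n"
    proof -
      have "- (real n + s * p) = - (s * p) - real n" by simp
      then show ?thesis using t\<rho> by (simp only: powr_diff powr_realpow)
    qed
    also have "(t * \<rho>) powr - (s * p) = t powr - (s * p) * \<rho> powr - (s * p)"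
      using t \<rho> by (simp add: powr_mult)
    finally have e: "(real n * (t * \<rho>)) powr - (real n + s * p)
      = real n powr - (real n + s * p) * (t powr - (s * p) * \<rho> powr - (s * p) / (t * \<rho>) ^ n)" .
    define Y where "Y = (t * \<rho>) ^ n"
    have Y: "0 < Y" using t\<rho> by (simp add: Y_def)
    have "(2 * (t * \<rho>)) ^ n = 2 ^ n * Y" unfolding Y_def by (rule power_mult_distrib)
    then have "(2 * (t * \<rho>)) ^ n / 2 * (real n * (t * \<rho>)) powr - (real n + s * p)
      = 2 ^ n / 2 * real n powr - (real n + s * p) * (t powr - (s * p) * \<rho> powr - (s * p))"
      unfolding e Y_def[symmetric] using Y by simp
    then show ?thesis by (simp only: mult_ac)
  qed
  also have "\<dots> \<le> g * J"
    unfolding J_def using start t \<rho> g by (intro mult_left_mono mult_right_mono) auto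
  finally show False by simp
qed

text \<open>The level \<open>h\<close> belonging to the width \<open>\<rho> / real K\<close>
  decreases as \<open>\<rho>\<close> grows, and \<open>w0\<close> is the width at which it equals
  \<Theta>/4; so propagation can begin at \<open>real K * w0\<close>. \<open>start\<close> says that
  the volume seen at \<open>r0\<close> already has density \<open>\<delta>\<close> there. Radii
  between consecutive powers of 4 lose a factor \<open>4 ^ n\<close>.\<close>

lemma density_growth:
  fixes K :: nat and t r0 w0 r :: real
  defines "\<delta> \<equiv> (1 / 2) ^ K" and "B \<equiv> 1 + Lam / c1"
  defines "C5 \<equiv> 8 ^ n + 2 * B * 4 ^ n"
  assumes K: "1 \<le> K" and w0: "0 < w0"
    and w0_eq: "w0 powr - (s * p) = c1 * ((1 + \<tau>) / 4) powr (m - 1) / (2 * tail_const n s p)"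
    and t: "0 < t" "real n * t \<le> 1" "(4 ^ n + 4 / (1 + \<tau>) * C5) * \<delta> = (2 * t) ^ n / 2"
    and big: "tail_const n s p * (C5 + 2 * B * 4 ^ n) * real K
      < ((1 + \<tau>) / 2) powr p / 2 * (2 ^ n / 2 * real n powr - (real n + s * p)) * t powr - (s * p)"
    and r0: "0 < r0" "r0 \<le> real K * w0" and start: "\<delta> * (real K * w0) ^ n \<le> hvol r0"
    and r: "r0 \<le> r" "ball_Rn n r \<subseteq> \<Omega>"
  shows "\<delta> / 4 ^ n * r ^ n \<le> hvol r"
proof -
  define \<rho>0 where "\<rho>0 = real K * w0"
  have \<rho>0: "0 < \<rho>0" "r0 \<le> \<rho>0" using K w0 r0 by (auto simp: \<rho>0_def)
  have \<delta>: "0 < \<delta>" by (simp add: \<delta>_def)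
  have chain: "\<delta> * (4 ^ k * \<rho>0) ^ n \<le> hvol (4 ^ k * \<rho>0)" if "4 ^ k * \<rho>0 \<le> r" for k
    using that
  proof (induction k)
    case 0
    then show ?case using start hvol_mono[OF \<rho>0(2)] by (simp add: \<rho>0_def)
  next
    case (Suc k)
    define \<rho> where "\<rho> = 4 ^ k * \<rho>0"
    have le: "4 * \<rho> \<le> r" using Suc.prems by (simp add: \<rho>_def)
    have \<rho>: "\<rho>0 \<le> \<rho>" "0 < \<rho>" using \<rho>0 by (auto simp: \<rho>_def)
    have IH: "\<delta> * \<rho> ^ n \<le> hvol \<rho>" using Suc.IH le \<rho> by (simp add: \<rho>_def)
    \<comment> \<open>The value that \<open>h powr (m - 1)\<close> must have for the hypothesis
      \<open>hw\<close> of \<open>hvol_doubling\<close>.\<close>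
    define H where "H = 2 * (tail_const n s p * (\<rho> / real K) powr - (s * p)) / c1"
    define h where "h = H powr (1 / (m - 1))"
    have H: "0 < H" using tail_pos \<rho> K c1 by (simp add: H_def)
    have h: "0 < h" using H by (simp add: h_def)
    have hm: "h powr (m - 1) = H" using H m by (simp add: h_def powr_powr)
    have "w0 \<le> \<rho> / real K" using \<rho> K by (simp add: \<rho>0_def field_simps)
    then have "(\<rho> / real K) powr - (s * p) \<le> w0 powr - (s * p)"
      using w0 s by (intro powr_mono2') auto
    then have "H \<le> 2 * (tail_const n s p * (w0 powr - (s * p))) / c1"
      unfolding H_def using c1 tail_pos by (intro divide_right_mono mult_left_mono) auto
    also have "\<dots> = ((1 + \<tau>) / 4) powr (m - 1)"
      unfolding w0_eq using c1 tail_pos by simp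
    finally have "h powr (m - 1) \<le> ((1 + \<tau>) / 4) powr (m - 1)" using hm by simp
    then have h': "h \<le> (1 + \<tau>) / 4"
      using powr_less_mono2[of "m - 1" "(1 + \<tau>) / 4" h] m tau by force
    have "\<delta> * (4 * \<rho>) ^ n \<le> hvol (4 * \<rho>)"
      unfolding \<delta>_def
    proof (rule hvol_doubling[OF K \<rho>(2) _ h h'])
      show "ball_Rn n (4 * \<rho>) \<subseteq> \<Omega>" using ball_Rn_mono[OF le, of n] r by auto
      show "c1 * h powr (m - 1) = 2 * (tail_const n s p * (\<rho> / real K) powr - (s * p))"
        unfolding hm H_def using c1 by simp
    qed (use t big IH in \<open>simp_all add: \<delta>_def B_def C5_def\<close>)
    then show ?case by (simp only: \<rho>_def power_Suc mult.assoc)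
  qed
  show ?thesis
  proof (cases "\<rho>0 \<le> r")
    case True
    \<comment> \<open>The least \<open>k\<close> beyond \<open>r\<close> is not 0, so its
      predecessor gives a radius of the chain below \<open>r\<close> and within a factor 4 of
      it.\<close>
    define P where "P k \<longleftrightarrow> r < 4 ^ k * \<rho>0" for k :: nat
    obtain k where "r / \<rho>0 < 4 ^ k" using real_arch_pow[of 4 "r / \<rho>0"] by auto
    then have "P k" using \<rho>0 by (simp add: P_def field_simps)
    then have L: "P (LEAST k. P k)" by (rule LeastI)
    moreover have "\<not> P 0" using True by (simp add: P_def)
    ultimately obtain k' where k': "(LEAST k. P k) = Suc k'" by (metis not0_implies_Suc)
    then have "\<not> P k'" by (metis lessI not_less_Least)
    then have le: "4 ^ k' * \<rho>0 \<le> r" by (simp add: P_def)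
    have "P (Suc k')" using L unfolding k' .
    then have lt: "r \<le> 4 * (4 ^ k' * \<rho>0)" by (simp add: P_def)
    have "\<delta> / 4 ^ n * r ^ n \<le> \<delta> / 4 ^ n * (4 * (4 ^ k' * \<rho>0)) ^ n"
      using lt \<delta> r r0 by (intro mult_left_mono power_mono) auto
    also have "\<dots> = \<delta> * (4 ^ k' * \<rho>0) ^ n"
      by (simp only: power_mult_distrib[of 4 "4 ^ k' * \<rho>0"]) simp
    also have "\<dots> \<le> hvol r" using chain[OF le] hvol_mono[OF le] by linarith
    finally show ?thesis .
  next
    \<comment> \<open>For \<open>r\<close> between \<open>r0\<close> and \<open>\<rho>0\<close>,
      \<open>start\<close> compares the volume at \<open>r0\<close> with the larger ball, so
      monotonicity suffices.\<close>
    case False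
    have "\<delta> / 4 ^ n * r ^ n \<le> \<delta> * r ^ n"
      using \<delta> r r0 by (simp add: divide_le_eq mult_le_cancel_left1 mult_ac)
    also have "\<dots> \<le> \<delta> * \<rho>0 ^ n"
      using False \<delta> r r0 by (intro mult_left_mono power_mono) auto
    also have "\<dots> \<le> hvol r" using start hvol_mono[OF r(1)] by (simp add: \<rho>0_def)
    finally show ?thesis .
  qed
qed

end

subsection \<open>The density estimate\<close>

text \<open>\<open>K\<close> is fixed before the potential, the domain and the minimizer are
  introduced, so the constant is uniform in them.\<close>

lemma density_constant_exists:
  assumes n: "1 \<le> n" and p: "1 < p" and s: "0 < s * p" "s * p < 1" and m: "1 < m"
    and Lam: "0 \<le> Lam" and c1: "0 < c1" and tau: "-1 < \<tau>" and r0: "0 < r0" and c0: "0 < c0"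
  shows "\<exists>ct\<in>{0<..<1}. \<forall>W W' \<Omega> u r. truncation_minimizer n s p m Lam c1 \<tau> W W' \<Omega> u \<longrightarrow>
    ennreal c0 \<le> emeasure (PiLeb n) {x \<in> ball_Rn n r0. \<tau> < u x} \<longrightarrow> r0 \<le> r \<longrightarrow> ball_Rn n r \<subseteq> \<Omega> \<longrightarrow>
    ennreal (ct * r ^ n) \<le> emeasure (PiLeb n) {x \<in> ball_Rn n r. \<tau> < u x}"
proof -
  define B where "B = 1 + Lam / c1"
  define C5 where "C5 = 8 ^ n + 2 * B * 4 ^ n"
  define V where "V = c1 * ((1 + \<tau>) / 4) powr (m - 1) / (2 * tail_const n s p)"
  have B: "0 < B" using Lam c1 by (simp add: B_def add_pos_nonneg)
  have C5: "0 < C5" using B by (simp add: C5_def add_pos_pos)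
  have tail: "0 < tail_const n s p" using p s by (intro tail_const_pos) auto
  have V: "0 < V" using c1 tau tail by (simp add: V_def)
  \<comment> \<open>The solution of \<open>w0 powr - (s * p) = V\<close>, that is, the width whose
    level is \<Theta>/4.\<close>
  define w0 where "w0 = V powr (- 1 / (s * p))"
  have "s \<noteq> 0" "p \<noteq> 0" using s by auto
  then have w0: "0 < w0" "w0 powr - (s * p) = V" using V by (simp_all add: w0_def powr_powr)
  have gain: "0 < ((1 + \<tau>) / 2) powr p / 2 * (2 ^ n / 2 * real n powr - (real n + s * p))"
    using tau n by simp
  have coeff: "0 < 4 ^ n + 4 / (1 + \<tau>) * C5"
    using tau C5 by (simp add: add_pos_pos)
  obtain K :: nat and t :: real where K: "1 \<le> K" and t: "0 < t" "real n * t \<le> 1"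
      "(4 ^ n + 4 / (1 + \<tau>) * C5) * (1 / 2) ^ K = (2 * t) ^ n / 2"
    and big: "tail_const n s p * (C5 + 2 * B * 4 ^ n) * real K
      < ((1 + \<tau>) / 2) powr p / 2 * (2 ^ n / 2 * real n powr - (real n + s * p)) * t powr - (s * p)"
    and K': "(1 / 2) ^ K * (real K * w0) ^ n \<le> c0" "r0 \<le> real K * w0"
    by (rule geometric_parameters_exist[OF n s(1) gain coeff c0 w0(1),
          where A = "tail_const n s p * (C5 + 2 * B * 4 ^ n)" and r = r0]) (rule that)
  show ?thesis
  proof (intro bexI[of _ "(1 / 2) ^ K / 4 ^ n"] allI impI)
    have "(1 / 2 :: real) ^ K < 1" using K by (simp add: power_less_one_iff)
    also have "(1 :: real) \<le> 4 ^ n" by simp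
    finally show "(1 / 2) ^ K / 4 ^ n \<in> {0<..<1::real}" by simp
  next
    fix W W' \<Omega> u r
    assume "truncation_minimizer n s p m Lam c1 \<tau> W W' \<Omega> u"
      and start: "ennreal c0 \<le> emeasure (PiLeb n) {x \<in> ball_Rn n r0. \<tau> < u x}"
      and r: "r0 \<le> r" "ball_Rn n r \<subseteq> \<Omega>"
    then interpret truncation_minimizer n s p m Lam c1 \<tau> W W' \<Omega> u by simp
    have "c0 \<le> hvol r0"
      using start c0 unfolding high_volume_def[symmetric] high_volume_eq by simp
    then have "(1 / 2) ^ K / 4 ^ n * r ^ n \<le> hvol r"
      using K w0 t big r0 K' r unfolding V_def B_def C5_def by (intro density_growth[of K w0 t r0]) auto
    then show "ennreal ((1 / 2) ^ K / 4 ^ n * r ^ n) \<le> emeasure (PiLeb n) {x \<in> ball_Rn n r. \<tau> < u x}"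
      unfolding high_volume_def[symmetric] high_volume_eq by (rule ennreal_leI)
  qed
qed

section \<open>From minimizers to the density estimate\<close>

lemma truncation_minimizer_of_minimizer_bdd:
  assumes n: "1 \<le> n" and p: "1 < p" and s: "0 < s * p" "s * p < 1" and m: "1 < m"
    and W_deriv: "\<And>x. x \<in> {-1..1} \<Longrightarrow> (W has_real_derivative W' x) (at x within {-1..1})"
    and W_nonneg: "\<And>x. x \<in> {-1..1} \<Longrightarrow> 0 \<le> W x"
    and W_le: "\<And>x. x \<in> {-1..1} \<Longrightarrow> W x \<le> Lam * \<bar>1 + x\<bar> powr m"
    and W'_ge: "\<And>x. -1 < x \<Longrightarrow> x < \<tau> \<Longrightarrow> c1 * \<bar>1 + x\<bar> powr (m - 1) \<le> W' x"
    and Lam: "0 \<le> Lam" and c1: "0 < c1" and tau: "-1 < \<tau>" "\<tau> < 0"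
    and \<Omega>: "open_Rn n \<Omega>" "bounded_Rn n \<Omega>" and u: "minimizer_bdd n s p W \<Omega> u"
  obtains u' where "AE x in PiLeb n. u x = u' x" "u' \<in> borel_measurable (PiLeb n)"
    "truncation_minimizer n s p m Lam c1 \<tau> W W' \<Omega> u'"
proof -
  obtain u' where [measurable]: "u' \<in> borel_measurable (PiLeb n)" and ae: "AE x in PiLeb n. u x = u' x"
    and bdd: "\<And>x. \<bar>u' x\<bar> \<le> 1"
    using minimizer_bdd_borel_representative[OF u] by blast
  have X: "u \<in> borel_measurable (Leb n)" "K_energy n s p u \<Omega> < \<infinity>" "AE x in PiLeb n. \<bar>u x\<bar> \<le> 1"
    using u by (auto simp: minimizer_bdd_def X_space_def AE_Leb_iff)
  have "truncation_minimizer n s p m Lam c1 \<tau> W W' \<Omega> u'"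
  proof
    show "\<Omega> \<in> sets (PiLeb n)" using \<Omega>(1) by (rule open_Rn_sets)
    show "emeasure (PiLeb n) \<Omega> < \<infinity>"
    proof -
      obtain R where "\<Omega> \<subseteq> ball_Rn n R" using \<Omega>(2) by (auto simp: bounded_Rn_def)
      also have "\<dots> \<subseteq> ball_Rn n \<bar>R\<bar>" by (rule ball_Rn_mono) simp
      finally have "emeasure (PiLeb n) \<Omega> \<le> emeasure (PiLeb n) (ball_Rn n \<bar>R\<bar>)"
        by (intro emeasure_mono) simp_all
      also have "\<dots> \<le> ennreal ((2 * \<bar>R\<bar>) ^ n)" by (rule emeasure_ball_Rn_le) simp
      finally show ?thesis by (simp add: le_less_trans)
    qed
    show "K_energy n s p u' \<Omega> < \<infinity>"
      using X(2) by (simp add: K_energy_cong_AE[OF ae])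
    show "E_energy n s p W u' \<Omega> \<le> E_energy n s p W (truncate n R c u') \<Omega>"
      if R: "ball_Rn n R \<subseteq> \<Omega>" and c: "\<bar>c\<bar> \<le> 1" and K: "K_energy n s p (truncate n R c u') \<Omega> < \<infinity>" for R c
    proof -
      \<comment> \<open>A competitor must equal \<open>u\<close> at every point outside \<Omega>, so
        the truncation of \<open>u\<close> itself is tested; that of \<open>u'\<close> agrees with
        it almost everywhere and has the same energy.\<close>
      have ae': "AE x in PiLeb n. truncate n R c u x = truncate n R c u' x"
        using ae by eventually_elim (simp add: truncate_def)
      have [measurable]: "ball_Rn n R \<in> sets (Leb n)" "u \<in> borel_measurable (Leb n)"
        using X(1) by (simp_all add: Leb_def)
      have "truncate n R c u \<in> borel_measurable (Leb n)"
        unfolding truncate_def by measurable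
      moreover have "AE x in PiLeb n. \<bar>truncate n R c u x\<bar> \<le> 1"
        using X(3) by eventually_elim (use c in \<open>auto simp: truncate_def\<close>)
      ultimately have "truncate n R c u \<in> X_space n s p \<Omega>"
        using K by (simp add: X_space_def AE_Leb_iff K_energy_cong_AE[OF ae'])
      moreover have "\<forall>x\<in>Rn n - \<Omega>. truncate n R c u x = u x"
        using R by (auto simp: truncate_def)
      ultimately have "E_energy n s p W u \<Omega> \<le> E_energy n s p W (truncate n R c u) \<Omega>"
        using u by (simp add: minimizer_bdd_def)
      then show ?thesis
        by (simp add: E_energy_cong_AE[OF ae] E_energy_cong_AE[OF ae'])
    qed
  qed (use assms bdd in \<open>simp_all\<close>)
  then show ?thesis by (intro that[of u']) (use ae in auto)
qed

lemma superlevel_sets_Leb: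
  fixes u :: "(nat \<Rightarrow> real) \<Rightarrow> real"
  assumes [measurable]: "u \<in> borel_measurable (Leb n)"
  shows "{x \<in> ball_Rn n r. t < u x} \<in> sets (Leb n)" "{x \<in> ball_Rn n r. t < u x \<and> u x \<le> t'} \<in> sets (Leb n)"
proof -
  have [measurable]: "ball_Rn n r \<in> sets (Leb n)" by (simp add: Leb_def)
  have "{x \<in> ball_Rn n r. t < u x} = {x \<in> space (Leb n). x \<in> ball_Rn n r \<and> t < u x}"
    "{x \<in> ball_Rn n r. t < u x \<and> u x \<le> t'} = {x \<in> space (Leb n). x \<in> ball_Rn n r \<and> t < u x \<and> u x \<le> t'}"
    by (auto simp: ball_Rn_def space_PiLeb Leb_def)
  then show "{x \<in> ball_Rn n r. t < u x} \<in> sets (Leb n)" "{x \<in> ball_Rn n r. t < u x \<and> u x \<le> t'} \<in> sets (Leb n)"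
    by simp_all
qed

lemma emeasure_superlevel_cong:
  fixes u u' :: "(nat \<Rightarrow> real) \<Rightarrow> real"
  assumes u: "u \<in> borel_measurable (Leb n)" and u': "u' \<in> borel_measurable (PiLeb n)"
    and ae: "AE x in PiLeb n. u x = u' x"
  shows "emeasure (Leb n) {x \<in> ball_Rn n r. t < u x} = emeasure (PiLeb n) {x \<in> ball_Rn n r. t < u' x}"
proof -
  note [measurable] = u'
  have "{x \<in> ball_Rn n r. t < u' x} = {x \<in> space (PiLeb n). x \<in> ball_Rn n r \<and> t < u' x}"
    by (auto simp: ball_Rn_def space_PiLeb)
  then have S: "{x \<in> ball_Rn n r. t < u' x} \<in> sets (PiLeb n)" by simp
  have "emeasure (Leb n) {x \<in> ball_Rn n r. t < u x} = emeasure (Leb n) {x \<in> ball_Rn n r. t < u' x}"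
  proof (rule emeasure_eq_AE)
    show "AE x in Leb n. x \<in> {x \<in> ball_Rn n r. t < u x} \<longleftrightarrow> x \<in> {x \<in> ball_Rn n r. t < u' x}"
      using ae unfolding AE_Leb_iff by eventually_elim simp
    show "{x \<in> ball_Rn n r. t < u' x} \<in> sets (Leb n)" using S by (simp add: Leb_def)
  qed (rule superlevel_sets_Leb[OF u])
  also have "\<dots> = emeasure (PiLeb n) {x \<in> ball_Rn n r. t < u' x}"
    using S by (simp add: Leb_def)
  finally show ?thesis .
qed

text \<open>As \<open>\<theta>2 \<le> \<theta>max\<close>, the two sets on the right cover the one
  on the left, and on the first the integrand is at least
  \<open>(1 + \<theta>min) powr m\<close>.\<close>

lemma superlevel_measure_le:
  fixes \<theta>min \<theta>max \<theta>2 m :: real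
  assumes u: "u \<in> borel_measurable (Leb n)" and th: "-1 < \<theta>min" "\<theta>2 \<le> \<theta>max" and m: "0 \<le> m"
  shows "emeasure (Leb n) {x \<in> ball_Rn n r. \<theta>min < u x}
    \<le> ennreal ((1 + \<theta>min) powr -m) *
        (\<integral>\<^sup>+x\<in>{x \<in> ball_Rn n r. \<theta>min < u x \<and> u x \<le> \<theta>max}. ennreal (\<bar>1 + u x\<bar> powr m) \<partial>Leb n)
      + emeasure (Leb n) {x \<in> ball_Rn n r. \<theta>2 < u x}"
proof -
  let ?A = "{x \<in> ball_Rn n r. \<theta>min < u x \<and> u x \<le> \<theta>max}" and ?B = "{x \<in> ball_Rn n r. \<theta>2 < u x}"
  note [measurable] = u and sets = superlevel_sets_Leb[OF u]
  have "{x \<in> ball_Rn n r. \<theta>min < u x} \<subseteq> ?A \<union> ?B" using th by auto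
  then have "emeasure (Leb n) {x \<in> ball_Rn n r. \<theta>min < u x} \<le> emeasure (Leb n) ?A + emeasure (Leb n) ?B"
    using sets by (intro order_trans[OF emeasure_mono emeasure_subadditive]) auto
  also have "emeasure (Leb n) ?A = (\<integral>\<^sup>+x. indicator ?A x \<partial>Leb n)"
    using sets by (simp add: nn_integral_indicator)
  also have "\<dots> \<le> (\<integral>\<^sup>+x. ennreal ((1 + \<theta>min) powr -m) * (ennreal (\<bar>1 + u x\<bar> powr m) * indicator ?A x) \<partial>Leb n)"
  proof (rule nn_integral_mono)
    fix x
    have "1 \<le> ennreal ((1 + \<theta>min) powr -m) * ennreal (\<bar>1 + u x\<bar> powr m)" if "x \<in> ?A"
    proof -
      have "(1 + \<theta>min) powr m \<le> \<bar>1 + u x\<bar> powr m"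
        using that th m by (intro powr_mono2) auto
      then have "1 \<le> (1 + \<theta>min) powr -m * \<bar>1 + u x\<bar> powr m"
        using th by (simp add: powr_minus field_simps)
      then show ?thesis by (simp add: ennreal_mult'[symmetric])
    qed
    then show "indicator ?A x \<le> ennreal ((1 + \<theta>min) powr -m) * (ennreal (\<bar>1 + u x\<bar> powr m) * indicator ?A x)"
      by (cases "x \<in> ?A") simp_all
  qed
  also have "\<dots> = ennreal ((1 + \<theta>min) powr -m) * (\<integral>\<^sup>+x\<in>?A. ennreal (\<bar>1 + u x\<bar> powr m) \<partial>Leb n)"
    by (intro nn_integral_cmult borel_measurable_times_ennreal borel_measurable_indicator sets(2)) measurable
  finally show ?thesis by (simp only: add_right_mono)
qed

text \<open>Choosing the constant from the listed parameters alone makes it a function of them,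
  which is how the claimed dependence is expressed.\<close>

definition density_constant ::
  "real \<Rightarrow> nat \<Rightarrow> real \<Rightarrow> real \<Rightarrow> real \<Rightarrow> real \<Rightarrow> real \<Rightarrow> real \<Rightarrow> real \<Rightarrow> real" where
  "density_constant s n p m Lam c1 \<tau> r0 c0 = (SOME ct. ct \<in> {0<..<1} \<and>
    (\<forall>W W' \<Omega> u r. truncation_minimizer n s p m Lam c1 \<tau> W W' \<Omega> u \<longrightarrow>
      ennreal c0 \<le> emeasure (PiLeb n) {x \<in> ball_Rn n r0. \<tau> < u x} \<longrightarrow> r0 \<le> r \<longrightarrow> ball_Rn n r \<subseteq> \<Omega> \<longrightarrow>
      ennreal (ct * r ^ n) \<le> emeasure (PiLeb n) {x \<in> ball_Rn n r. \<tau> < u x}))"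

lemma density_constant:
  assumes "1 \<le> n" "1 < p" "0 < s * p" "s * p < 1" "1 < m" "0 \<le> Lam" "0 < c1" "-1 < \<tau>" "0 < r0" "0 < c0"
  shows "density_constant s n p m Lam c1 \<tau> r0 c0 \<in> {0<..<1}"
    and "truncation_minimizer n s p m Lam c1 \<tau> W W' \<Omega> u \<Longrightarrow>
      ennreal c0 \<le> emeasure (PiLeb n) {x \<in> ball_Rn n r0. \<tau> < u x} \<Longrightarrow> r0 \<le> r \<Longrightarrow> ball_Rn n r \<subseteq> \<Omega> \<Longrightarrow>
      ennreal (density_constant s n p m Lam c1 \<tau> r0 c0 * r ^ n) \<le> emeasure (PiLeb n) {x \<in> ball_Rn n r. \<tau> < u x}"
proof -
  have "density_constant s n p m Lam c1 \<tau> r0 c0 \<in> {0<..<1} \<and>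
    (\<forall>W W' \<Omega> u r. truncation_minimizer n s p m Lam c1 \<tau> W W' \<Omega> u \<longrightarrow>
      ennreal c0 \<le> emeasure (PiLeb n) {x \<in> ball_Rn n r0. \<tau> < u x} \<longrightarrow> r0 \<le> r \<longrightarrow> ball_Rn n r \<subseteq> \<Omega> \<longrightarrow>
      ennreal (density_constant s n p m Lam c1 \<tau> r0 c0 * r ^ n) \<le> emeasure (PiLeb n) {x \<in> ball_Rn n r. \<tau> < u x})"
    unfolding density_constant_def
    by (rule someI_ex) (use density_constant_exists[OF assms] in \<open>simp only: Bex_def\<close>)
  then show "density_constant s n p m Lam c1 \<tau> r0 c0 \<in> {0<..<1}"
    and "truncation_minimizer n s p m Lam c1 \<tau> W W' \<Omega> u \<Longrightarrow>
      ennreal c0 \<le> emeasure (PiLeb n) {x \<in> ball_Rn n r0. \<tau> < u x} \<Longrightarrow> r0 \<le> r \<Longrightarrow> ball_Rn n r \<subseteq> \<Omega> \<Longrightarrow>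
      ennreal (density_constant s n p m Lam c1 \<tau> r0 c0 * r ^ n) \<le> emeasure (PiLeb n) {x \<in> ball_Rn n r. \<tau> < u x}"
    by blast+
qed

text \<open>A bounded \<Omega> serves itself. Otherwise the ball of radius \<open>r\<close> does:
  its closure lies in the ball of radius \<open>3 * r / 2\<close>, so it is compactly
  contained.\<close>

lemma minimizer_local:
  assumes u: "minimizer n s p W \<Omega> u" and \<Omega>: "open_Rn n \<Omega>" and r: "0 < r" "ball_Rn n (3 * r / 2) \<subseteq> \<Omega>"
  obtains \<Omega>' where "open_Rn n \<Omega>'" "bounded_Rn n \<Omega>'" "ball_Rn n r \<subseteq> \<Omega>'" "minimizer_bdd n s p W \<Omega>' u"
proof (cases "bounded_Rn n \<Omega>")
  case True
  have "ball_Rn n r \<subseteq> \<Omega>"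
    using ball_Rn_mono[of r "3 * r / 2" n] r by auto
  then show ?thesis using True u \<Omega> by (intro that[of \<Omega>]) (auto simp: minimizer_def)
next
  case False
  have cl: "powertop_real {..<n} closure_of ball_Rn n r \<subseteq> \<Omega>"
    using closure_of_ball_Rn_subset[of r "3 * r / 2" n] r by auto
  have bd: "bounded_Rn n (ball_Rn n r)" by (auto simp: bounded_Rn_def)
  then have "minimizer_bdd n s p W (ball_Rn n r) u"
    using False u cl open_Rn_ball_Rn[of n r] by (simp add: minimizer_def)
  then show ?thesis using bd by (intro that[of "ball_Rn n r"] open_Rn_ball_Rn) auto
qed

lemma density_estimate:
  fixes n :: nat and s p m Lam c1 \<tau> \<theta>1 r0 c0 r :: real
  assumes n: "1 \<le> n" and p: "1 < p" and s: "0 < s" "s * p < 1" and m: "1 < m"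
    and W: "\<And>x. x \<in> {-1..1} \<Longrightarrow> 0 \<le> W x \<and> (W has_real_derivative W' x) (at x within {-1..1}) \<and> W x \<le> Lam * \<bar>1 + x\<bar> powr m"
    and W': "\<And>x. -1 < x \<Longrightarrow> x < \<tau> \<Longrightarrow> c1 * \<bar>1 + x\<bar> powr (m - 1) \<le> W' x"
    and Lam: "0 \<le> Lam" and c1: "0 < c1" and tau: "-1 < \<tau>" "\<tau> < 0" "\<tau> \<le> \<theta>1"
    and \<Omega>: "open_Rn n \<Omega>" and u: "minimizer n s p W \<Omega> u"
    and r0: "0 < r0" and c0: "0 < c0" and start: "ennreal c0 < emeasure (Leb n) {x \<in> ball_Rn n r0. \<theta>1 < u x}"
    and r: "r0 \<le> r" "ball_Rn n (3 * r / 2) \<subseteq> \<Omega>"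
  shows "u \<in> borel_measurable (Leb n)"
    and "ennreal (density_constant s n p m Lam c1 \<tau> r0 c0 * r ^ n) \<le> emeasure (Leb n) {x \<in> ball_Rn n r. \<tau> < u x}"
proof -
  have "0 < r" using r r0 by simp
  \<comment> \<open>The domain may change with \<open>r\<close>; the constant is uniform in the
    domain.\<close>
  obtain \<Omega>' where \<Omega>': "open_Rn n \<Omega>'" "bounded_Rn n \<Omega>'" "ball_Rn n r \<subseteq> \<Omega>'" "minimizer_bdd n s p W \<Omega>' u"
    using minimizer_local[OF u \<Omega> \<open>0 < r\<close> r(2)] by blast
  show um: "u \<in> borel_measurable (Leb n)"
    using \<Omega>'(4) by (simp add: minimizer_bdd_def X_space_def)
  have sp: "0 < s * p" using s p by simp
  obtain u' where u': "AE x in PiLeb n. u x = u' x" "u' \<in> borel_measurable (PiLeb n)"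
      "truncation_minimizer n s p m Lam c1 \<tau> W W' \<Omega>' u'"
    by (rule truncation_minimizer_of_minimizer_bdd[of n p s m W W' Lam \<tau> c1 \<Omega>' u])
      (use n p sp s m W W' Lam c1 tau \<Omega>' in auto)
  note eq = emeasure_superlevel_cong[OF um u'(2,1)]
  have "ennreal c0 \<le> emeasure (Leb n) {x \<in> ball_Rn n r0. \<tau> < u x}"
    using start tau
    by (intro order_trans[OF less_imp_le[OF start] emeasure_mono] superlevel_sets_Leb[OF um]) auto
  then show "ennreal (density_constant s n p m Lam c1 \<tau> r0 c0 * r ^ n) \<le> emeasure (Leb n) {x \<in> ball_Rn n r. \<tau> < u x}"
    unfolding eq by (intro density_constant(2)[OF n p sp s(2) m Lam c1 tau(1) r0 c0 u'(3)] r \<Omega>'(3))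
qed

theorem theorem1p3:
  "\<exists>(Rstar :: real \<Rightarrow> nat \<Rightarrow> real \<Rightarrow> real \<Rightarrow> real \<Rightarrow> real \<Rightarrow> real)
    (ctilde :: real \<Rightarrow> nat \<Rightarrow> real \<Rightarrow> real \<Rightarrow> real \<Rightarrow> real \<Rightarrow> real \<Rightarrow> real \<Rightarrow> real \<Rightarrow> real)
    (c :: real \<Rightarrow> real \<Rightarrow> real).
   \<forall>(n :: nat) (\<Omega> :: (nat \<Rightarrow> real) set) (p :: real) (s :: real)
    (W :: real \<Rightarrow> real) (W' :: real \<Rightarrow> real) (\<theta> :: real) (lam :: real) (Lam :: real) (m :: real)
    (q :: real) (c1 :: real) (\<theta>1 :: real) (\<theta>2 :: real) (\<theta>min :: real) (\<theta>max :: real)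
    (u :: (nat \<Rightarrow> real) \<Rightarrow> real) (c0 :: real) (r0 :: real).
     1 \<le> n \<and> open_Rn n \<Omega> \<and> 1 < p \<and> s \<in> {0<..<1/p} \<and>
     (\<forall>x\<in>{-1..1}. 0 \<le> W x \<and> (W has_real_derivative W' x) (at x within {-1..1})) \<and>
     continuous_on {-1..1} W' \<and>
     \<theta> \<in> {-1<..<1} \<and> lam \<in> {0<..1} \<and> 1 \<le> Lam \<and> p \<le> m \<and>
     (\<forall>x\<in>{-1..1}. lam * indicator {..\<theta>} x * \<bar>1 + x\<bar> powr m \<le> W x \<and>
                    W x \<le> Lam * \<bar>1 + x\<bar> powr m) \<and>
     q \<in> {0<..\<theta> + 1} \<inter> {0<..<1} \<and> 0 < c1 \<and>
     (\<forall>x\<in>{-1<..<-1 + q}. c1 * \<bar>1 + x\<bar> powr (m - 1) \<le> W' x) \<and>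
     \<theta>1 \<in> {-1<..\<theta>} \<and> \<theta>2 \<in> {-1<..\<theta>} \<and>
     \<theta>min = min \<theta>1 (min \<theta>2 (-1 + q)) \<and> \<theta>max = max \<theta>1 (max \<theta>2 (-1 + q)) \<and>
     minimizer n s p W \<Omega> u \<and>
     0 < c0 \<and> 0 < r0 \<and> ball_Rn n r0 \<subseteq> \<Omega> \<and>
     emeasure (Leb n) {x \<in> ball_Rn n r0. \<theta>1 < u x} > ennreal c0
     \<longrightarrow>
     r0 \<le> Rstar s n p m \<theta>min r0 \<and>
     ctilde s n p m Lam c1 \<theta>min r0 c0 \<in> {0<..<1} \<and>
     0 < c m \<theta>min \<and>
     (\<forall>r \<ge> Rstar s n p m \<theta>min r0. ball_Rn n (3 * r / 2) \<subseteq> \<Omega> \<longrightarrow>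
        ennreal (c m \<theta>min) *
            (\<integral>\<^sup>+x\<in>{x \<in> ball_Rn n r. \<theta>min < u x \<and> u x \<le> \<theta>max}. ennreal (\<bar>1 + u x\<bar> powr m) \<partial>Leb n)
          + emeasure (Leb n) {x \<in> ball_Rn n r. \<theta>2 < u x}
        \<ge> ennreal (ctilde s n p m Lam c1 \<theta>min r0 c0 * r ^ n))"
proof (rule exI[of _ "\<lambda>s n p m \<theta>min r0. r0"], rule exI[of _ density_constant],
    rule exI[of _ "\<lambda>m \<theta>min. (1 + \<theta>min) powr - m"], intro allI impI, elim conjE, intro conjI allI impI)
  fix n :: nat and \<Omega> :: "(nat \<Rightarrow> real) set" and p s :: real and W W' :: "real \<Rightarrow> real"
    and \<theta> lam Lam m q c1 \<theta>1 \<theta>2 \<theta>min \<theta>max :: real and u :: "(nat \<Rightarrow> real) \<Rightarrow> real" and c0 r0 :: real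
  assume n: "1 \<le> n" and \<Omega>: "open_Rn n \<Omega>" and p: "1 < p" and s: "s \<in> {0<..<1 / p}"
    and W: "\<forall>x\<in>{-1..1}. 0 \<le> W x \<and> (W has_real_derivative W' x) (at x within {-1..1})"
    and \<theta>: "\<theta> \<in> {-1<..<1}" and Lam: "1 \<le> Lam" and pm: "p \<le> m"
    and Wb: "\<forall>x\<in>{-1..1}. lam * indicator {..\<theta>} x * \<bar>1 + x\<bar> powr m \<le> W x \<and> W x \<le> Lam * \<bar>1 + x\<bar> powr m"
    and q: "q \<in> {0<..\<theta> + 1} \<inter> {0<..<1}" and c1: "0 < c1"
    and W': "\<forall>x\<in>{-1<..<-1 + q}. c1 * \<bar>1 + x\<bar> powr (m - 1) \<le> W' x"
    and \<theta>12: "\<theta>1 \<in> {-1<..\<theta>}" "\<theta>2 \<in> {-1<..\<theta>}"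
    and \<theta>min: "\<theta>min = min \<theta>1 (min \<theta>2 (-1 + q))" and \<theta>max: "\<theta>max = max \<theta>1 (max \<theta>2 (-1 + q))"
    and u: "minimizer n s p W \<Omega> u" and c0: "0 < c0" and r0: "0 < r0"
    and start: "ennreal c0 < emeasure (Leb n) {x \<in> ball_Rn n r0. \<theta>1 < u x}"
  have tau: "-1 < \<theta>min" "\<theta>min < 0" "\<theta>min \<le> \<theta>1" "\<theta>min \<le> -1 + q" "\<theta>2 \<le> \<theta>max"
    using \<theta>min \<theta>max \<theta>12 q by auto
  have sp: "0 < s" "s * p < 1" "0 < s * p" using s p by (auto simp: field_simps)
  \<comment> \<open>The radius R* is \<open>r0\<close> itself, since \<open>density_growth\<close>
    covers all radii from \<open>r0\<close> on.\<close>
  show "r0 \<le> r0" ..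
  show "density_constant s n p m Lam c1 \<theta>min r0 c0 \<in> {0<..<1}"
    using n p sp pm Lam c1 tau r0 c0 by (intro density_constant(1)) auto
  \<comment> \<open>This \<open>c\<close> normalizes the integrand, which is at least
    \<open>(1 + \<theta>min) powr m\<close> on the middle set.\<close>
  show "0 < (1 + \<theta>min) powr - m" using tau by simp
  fix r assume r: "r0 \<le> r" "ball_Rn n (3 * r / 2) \<subseteq> \<Omega>"
  have W'': "c1 * \<bar>1 + x\<bar> powr (m - 1) \<le> W' x" if "-1 < x" "x < \<theta>min" for x
    using W' that tau by auto
  have um: "u \<in> borel_measurable (Leb n)"
    and "ennreal (density_constant s n p m Lam c1 \<theta>min r0 c0 * r ^ n) \<le> emeasure (Leb n) {x \<in> ball_Rn n r. \<theta>min < u x}"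
    using density_estimate[of n p s m W W' Lam \<theta>min c1 \<theta>1 \<Omega> u r0 c0 r] n p sp pm W Wb W'' Lam c1 tau \<Omega> u r0 c0 start r
    by auto
  note this(2)
  also have "emeasure (Leb n) {x \<in> ball_Rn n r. \<theta>min < u x}
     \<le> ennreal ((1 + \<theta>min) powr - m) *
        (\<integral>\<^sup>+x\<in>{x \<in> ball_Rn n r. \<theta>min < u x \<and> u x \<le> \<theta>max}. ennreal (\<bar>1 + u x\<bar> powr m) \<partial>Leb n)
      + emeasure (Leb n) {x \<in> ball_Rn n r. \<theta>2 < u x}"
    using um tau p pm by (intro superlevel_measure_le) auto
  finally show "ennreal (density_constant s n p m Lam c1 \<theta>min r0 c0 * r ^ n)
     \<le> ennreal ((1 + \<theta>min) powr - m) *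
        (\<integral>\<^sup>+x\<in>{x \<in> ball_Rn n r. \<theta>min < u x \<and> u x \<le> \<theta>max}. ennreal (\<bar>1 + u x\<bar> powr m) \<partial>Leb n)
      + emeasure (Leb n) {x \<in> ball_Rn n r. \<theta>2 < u x}"
    .
qed

end
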